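(* (Denoising score matching on time-series.) Let $\mathbf{x}_{1:T}=(\mathbf{x}_1,\dots,\mathbf{x}_T)\sim p(\mathbf{x}_{1:T})$ be a time-series sample and, for $t\in\{1,\dots,T\}$ and $s\in[0,1]$, let $\mathbf{x}_{1:t}^s$ be the sample diffused from $\mathbf{x}_{1:t}$ at diffusion step $s$. Let $M_\theta$ be a conditional score network with parameter $\theta$, and let $$l_1(t,s)=\mathbb{E}_{\mathbf{x}_{1:t}^s}\left[\left\|M_\theta(s,\mathbf{x}_{1:t}^s,\mathbf{x}_{1:t-1})-\nabla_{\mathbf{x}_{1:t}^s}\log p(\mathbf{x}_{1:t}^s\mid\mathbf{x}_{1:t-1})\right\|_2^2\right],$$ where $\mathbf{x}_{1:t}^s$ is sampled from $p(\mathbf{x}_{1:t}^s\mid\mathbf{x}_{1:t-1})$, and $$L_1=\mathbb{E}_s\mathbb{E}_{\mathbf{x}_{1:T}}\left[\sum_{t=1}^T\lambda(s)\,l_1(t,s)\right].$$ Then $l_1(t,s)$ can be replaced by the following $l_2(t,s)$: $$l_2(t,s)=\mathbb{E}_{\mathbf{x}_t}\mathbb{E}_{\mathbf{x}_{1:t}^s}\left[\left\|M_\theta(s,\mathbf{x}_{1:t}^s,\mathbf{x}_{1:t-1})-\nabla_{\mathbf{x}_{1:t}^s}\log p(\mathbf{x}_{1:t}^s\mid\mathbf{x}_{1:t})\right\|_2^2\right],$$ where $\mathbf{x}_t$ and $\mathbf{x}_{1:t}^s$ are sampled from $p(\mathbf{x}_t\mid\mathbf{x}_{1:t-1})$ and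 $p(\mathbf{x}_{1:t}^s\mid\mathbf{x}_{1:t})$, respectively. Therefore, one can use the alternative objective $$L_2=\mathbb{E}_s\mathbb{E}_{\mathbf{x}_{1:T}}\left[\sum_{t=1}^T\lambda(s)\,l_2(t,s)\right]$$ instead of $L_1$.
   Context: Each $\mathbf{x}_t$ is a multi-dimensional real observation at time $t$ of a time-series of length $T$, and $\mathbf{x}_{1:t}=(\mathbf{x}_1,\dots,\mathbf{x}_t)$. The letter $p$ denotes the relevant joint, marginal or conditional probability density. The convention $\mathbf{x}_0=\mathbf{0}$ is used for the condition when $t=1$. Diffusion: $\mathbf{x}_{1:t}^s$, $s\in[0,1]$, is obtained from $\mathbf{x}_{1:t}$ (its value at $s=0$) by running the forward stochastic differential equation $d\mathbf{x}^s=\mathbf{f}(s,\mathbf{x}^s)\,ds+g(s)\,d\mathbf{w}$, where $\mathbf{w}$ is Brownian motion, $\mathbf{f}(s,\cdot)$ is a vector-valued drift that is affine in the state, and $g:[0,1]\to\mathbb{R}$ is a scalar diffusion function. Because the drift is affine, the transition kernel $p(\mathbf{x}_{1:t}^s\mid\mathbf{x}_{1:t})$ is Gaussian and its score $\nabla_{\mathbf{x}_{1:t}^s}\log p(\mathbf{x}_{1:t}^s\mid\mathbf{x}_{1:t})$ can be computed analytically. The density $p(\mathbf{x}_{1:t}^s\mid\mathbf{x}_{1:t-1})$ is the conditional density of the diffused sample given only the first $t-1$ clean observations. The conditional score network $M_\theta$ takes as input the diffusion step $s$, the diffused sample $\mathbf{x}_{1:t}^s$ and the condition $\mathbf{x}_{1:t-1}$,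 and outputs a vector of the same dimension as $\mathbf{x}_{1:t}^s$. Its parameter $\theta$ is trained by minimizing the objective, and it is meant to learn the gradient of the conditional log-likelihood. $\lambda:[0,1]\to\mathbb{R}$ is a weight function, $\mathbb{E}_s$ is expectation over $s$ uniform on $[0,1]$, and $\mathbb{E}_{\mathbf{x}_{1:T}}$ is expectation over $\mathbf{x}_{1:T}\sim p(\mathbf{x}_{1:T})$. The quantities $l_1$ and $l_2$ are losses used as training objectives in $\theta$.
   Formalization: The replacement of l_1 by l_2 is stated for s in (0,1], since at s=0 the transition kernel has no density or score, and L_2 replaces L_1 (equal up to a constant, same minimizers) for parameters where L_2 converges absolutely; otherwise L_2 may be infinite for every θ while L_1 is finite. *)

theory Defs
  imports "HOL-Probability.Probability"
begin

text \<open>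
  Observations live in a Euclidean space \<open>'a\<close>. A block \<open>x\<^sub>1, \<dots>, x\<^sub>t\<close> is a function
  \<open>nat \<Rightarrow> 'a\<close> that is \<open>undefined\<close> outside \<open>{1..t}\<close>, so that the dimension of the block may
  depend on \<open>t\<close>; the reference measure for densities is Lebesgue measure on each coordinate.
\<close>

abbreviation block_space :: "nat set \<Rightarrow> (nat \<Rightarrow> 'a::euclidean_space) measure" where
  "block_space I \<equiv> Pi\<^sub>M I (\<lambda>_. lborel)"

definition block_sqnorm :: "nat set \<Rightarrow> (nat \<Rightarrow> 'a::euclidean_space) \<Rightarrow> real" where
  "block_sqnorm I u = (\<Sum>i\<in>I. (norm (u i))\<^sup>2)"

definition block_apply ::
    "nat set \<Rightarrow> (nat \<Rightarrow> nat \<Rightarrow> 'a::euclidean_space \<Rightarrow>\<^sub>L 'a) \<Rightarrow> (nat \<Rightarrow> 'a) \<Rightarrow> nat \<Rightarrow> 'a" where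
  "block_apply I A x i = (\<Sum>j\<in>I. blinfun_apply (A i j) (x j))"

definition block_affine :: "nat set \<Rightarrow> ((nat \<Rightarrow> 'a::euclidean_space) \<Rightarrow> nat \<Rightarrow> 'a) \<Rightarrow> bool" where
  "block_affine I f \<longleftrightarrow>
     (\<exists>A b. \<forall>x\<in>extensional I. \<forall>i\<in>I. f x i = block_apply I A x i + b i)"

definition block_inner :: "nat set \<Rightarrow> (nat \<Rightarrow> 'a::euclidean_space) \<Rightarrow> (nat \<Rightarrow> 'a) \<Rightarrow> real" where
  "block_inner I u v = (\<Sum>i\<in>I. u i \<bullet> v i)"

definition block_pos_def :: "nat set \<Rightarrow> (nat \<Rightarrow> nat \<Rightarrow> 'a::euclidean_space \<Rightarrow>\<^sub>L 'a) \<Rightarrow> bool" where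
  "block_pos_def I P \<longleftrightarrow>
     (\<forall>u v. block_inner I u (block_apply I P v) = block_inner I (block_apply I P u) v) \<and>
     (\<forall>u. (\<exists>i\<in>I. u i \<noteq> 0) \<longrightarrow> block_inner I u (block_apply I P u) > 0)"

text \<open>The gradient of \<open>log f\<close> at \<open>y\<close>; its \<open>i\<close>-th component is the gradient in the \<open>i\<close>-th observation.\<close>

definition score :: "nat set \<Rightarrow> ((nat \<Rightarrow> 'a::euclidean_space) \<Rightarrow> real) \<Rightarrow> (nat \<Rightarrow> 'a) \<Rightarrow> nat \<Rightarrow> 'a" where
  "score I f y = (\<lambda>i\<in>I. THE D. GDERIV (\<lambda>v. ln (f (y(i := v)))) (y i) :> D)"


section \<open>The forward diffusion\<close>

definition brownian_motion ::
    "'w measure \<Rightarrow> nat set \<Rightarrow> (real \<Rightarrow> 'w \<Rightarrow> nat \<Rightarrow> 'a::euclidean_space) \<Rightarrow> bool" where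
  "brownian_motion N I W \<longleftrightarrow>
     (\<forall>s\<in>{0..1}. \<forall>i\<in>I. (\<lambda>\<omega>. W s \<omega> i) \<in> borel_measurable N) \<and>
     (AE \<omega> in N. \<forall>i\<in>I. W 0 \<omega> i = 0) \<and>
     (AE \<omega> in N. \<forall>i\<in>I. continuous_on {0..1} (\<lambda>s. W s \<omega> i)) \<and>
     (\<forall>r s. 0 \<le> r \<and> r < s \<and> s \<le> 1 \<longrightarrow> (\<forall>i\<in>I. \<forall>b\<in>Basis.
        distributed N lborel (\<lambda>\<omega>. (W s \<omega> i - W r \<omega> i) \<bullet> b) (normal_density 0 (sqrt (s - r))))) \<and>
     (\<forall>(n::nat) \<tau>. 0 \<le> \<tau> 0 \<and> (\<forall>k<n. \<tau> k < \<tau> (Suc k)) \<and> \<tau> n \<le> 1 \<longrightarrow>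
        prob_space.indep_vars N (\<lambda>_. borel)
          (\<lambda>(k, i, b) \<omega>. (W (\<tau> (Suc k)) \<omega> i - W (\<tau> k) \<omega> i) \<bullet> b) ({..<n} \<times> I \<times> Basis))"

text \<open>
  \<open>Y\<close> is (a version of) the stochastic integral of the deterministic integrand \<open>g\<close> against \<open>B\<close>
  over \<open>[0, s]\<close>: the mean-square limit of the integrals of step functions tending to \<open>g\<close> in
  \<open>L\<^sup>2([0, s])\<close>. By the Ito isometry the limit is almost surely unique.
\<close>

definition has_wiener_integral ::
    "'w measure \<Rightarrow> (real \<Rightarrow> 'w \<Rightarrow> 'a::euclidean_space) \<Rightarrow> (real \<Rightarrow> real) \<Rightarrow> real \<Rightarrow> ('w \<Rightarrow> 'a) \<Rightarrow> bool" where
  "has_wiener_integral N B g s Y \<longleftrightarrow>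
     Y \<in> borel_measurable N \<and>
     (\<forall>\<epsilon>>0. \<exists>(n::nat) \<tau> c.
        \<tau> 0 = 0 \<and> \<tau> n = s \<and> (\<forall>k<n. \<tau> k \<le> \<tau> (Suc k)) \<and>
        (\<integral>\<^sup>+u\<in>{0..s}. ennreal ((g u - (\<Sum>k<n. c k * indicator {\<tau> k<..\<tau> (Suc k)} u))\<^sup>2) \<partial>lborel)
          < ennreal \<epsilon> \<and>
        (\<integral>\<^sup>+\<omega>. ennreal ((norm (Y \<omega> - (\<Sum>k<n. c k *\<^sub>R (B (\<tau> (Suc k)) \<omega> - B (\<tau> k) \<omega>))))\<^sup>2) \<partial>N)
          < ennreal \<epsilon>)"

text \<open>
  \<open>X\<close> solves \<open>dX = f(s, X) ds + g(s) dW\<close> on \<open>[0, 1]\<close> with \<open>X 0 = x\<close>: the noise part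
  \<open>X s - x - \<integral>\<^sub>0\<^sup>s f(u, X u) du\<close> is the stochastic integral of \<open>g\<close>.
\<close>

definition sde_solution ::
    "'w measure \<Rightarrow> nat set \<Rightarrow> (real \<Rightarrow> 'w \<Rightarrow> nat \<Rightarrow> 'a::euclidean_space) \<Rightarrow>
     (real \<Rightarrow> (nat \<Rightarrow> 'a) \<Rightarrow> nat \<Rightarrow> 'a) \<Rightarrow> (real \<Rightarrow> real) \<Rightarrow> (nat \<Rightarrow> 'a) \<Rightarrow>
     (real \<Rightarrow> 'w \<Rightarrow> nat \<Rightarrow> 'a) \<Rightarrow> bool" where
  "sde_solution N I W f g x X \<longleftrightarrow>
     (\<forall>s\<in>{0..1}. X s \<in> measurable N (block_space I)) \<and>
     (AE \<omega> in N. \<forall>i\<in>I. continuous_on {0..1} (\<lambda>s. X s \<omega> i)) \<and>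
     (AE \<omega> in N. \<forall>i\<in>I. set_integrable lborel {0..1} (\<lambda>u. f u (X u \<omega>) i)) \<and>
     (\<forall>s\<in>{0..1}. \<forall>i\<in>I.
        has_wiener_integral N (\<lambda>u \<omega>. W u \<omega> i) g s
          (\<lambda>\<omega>. X s \<omega> i - x i - (LINT u:{0..s}|lborel. f u (X u \<omega>) i)))"

text \<open>
  \<open>q x y\<close> is the density at \<open>y\<close> of a nondegenerate Gaussian whose mean is affine in \<open>x\<close> and whose
  covariance does not depend on \<open>x\<close>. \<open>P\<close> is the inverse covariance, and \<open>\<kappa>\<close> is the normalizing
  constant, which is determined by \<open>P\<close> as soon as \<open>q x\<close> is a probability density.
\<close>

definition gaussian_transition ::
    "nat set \<Rightarrow> ((nat \<Rightarrow> 'a::euclidean_space) \<Rightarrow> (nat \<Rightarrow> 'a) \<Rightarrow> real) \<Rightarrow> bool" where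
  "gaussian_transition I q \<longleftrightarrow>
     (\<exists>m P \<kappa>. block_affine I m \<and> block_pos_def I P \<and>
        (\<forall>x\<in>extensional I. \<forall>y\<in>extensional I.
           let z = (\<lambda>i. y i - m x i) in q x y = \<kappa> * exp (- block_inner I z (block_apply I P z) / 2)))"


section \<open>Densities derived from the density of the time series\<close>

text \<open>
  Throughout, \<open>p\<close> is the density of \<open>x\<^sub>1, \<dots>, x\<^sub>T\<close>, and \<open>q t s x y\<close> is the density at \<open>y\<close> of the
  diffused sample at step \<open>s\<close> given \<open>x\<^sub>1, \<dots>, x\<^sub>t\<close>.
\<close>

definition marginal :: "nat \<Rightarrow> ((nat \<Rightarrow> 'a::euclidean_space) \<Rightarrow> real) \<Rightarrow> nat \<Rightarrow> (nat \<Rightarrow> 'a) \<Rightarrow> real" where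
  "marginal T p t x = (LINT z|block_space {Suc t..T}. p (merge {1..t} {Suc t..T} (x, z)))"

text \<open>The density at \<open>v\<close> of \<open>x\<^sub>t\<close> given \<open>x\<^sub>1, \<dots>, x\<^bsub>t-1\<^esub>\<close>; only these coordinates of \<open>x\<close> matter.\<close>

definition next_density ::
    "nat \<Rightarrow> ((nat \<Rightarrow> 'a::euclidean_space) \<Rightarrow> real) \<Rightarrow> nat \<Rightarrow> (nat \<Rightarrow> 'a) \<Rightarrow> 'a \<Rightarrow> real" where
  "next_density T p t x v = marginal T p t (x(t := v)) / marginal T p (t - 1) x"

text \<open>
  The density at \<open>y\<close> of the diffused sample given \<open>x\<^sub>1, \<dots>, x\<^bsub>t-1\<^esub>\<close>: the joint density of the diffused
  sample and \<open>x\<^sub>1, \<dots>, x\<^sub>t\<close> with \<open>x\<^sub>t\<close> integrated out, divided by the density of the condition.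
\<close>

definition diffused_density ::
    "nat \<Rightarrow> ((nat \<Rightarrow> 'a::euclidean_space) \<Rightarrow> real) \<Rightarrow>
     (nat \<Rightarrow> real \<Rightarrow> (nat \<Rightarrow> 'a) \<Rightarrow> (nat \<Rightarrow> 'a) \<Rightarrow> real) \<Rightarrow>
     nat \<Rightarrow> real \<Rightarrow> (nat \<Rightarrow> 'a) \<Rightarrow> (nat \<Rightarrow> 'a) \<Rightarrow> real" where
  "diffused_density T p q t s x y =
     (LINT v|lborel. q t s (restrict (x(t := v)) {1..t}) y * marginal T p t (x(t := v))) /
     marginal T p (t - 1) x"

text \<open>The condition \<open>x\<^sub>1, \<dots>, x\<^bsub>t-1\<^esub>\<close> given to the network, which is \<open>x\<^sub>0 = 0\<close> when \<open>t = 1\<close>.\<close>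

definition cond_idx :: "nat \<Rightarrow> nat set" where
  "cond_idx t = (if t = 1 then {0} else {1..t - 1})"

definition condition :: "nat \<Rightarrow> (nat \<Rightarrow> 'a::euclidean_space) \<Rightarrow> nat \<Rightarrow> 'a" where
  "condition t x = restrict (x(0 := 0)) (cond_idx t)"


section \<open>Losses and objectives\<close>

text \<open>
  \<open>M t s y c\<close> is the network, for one value of its parameter, on blocks of length \<open>t\<close>. The losses
  are expectations of nonnegative quantities and take values in \<open>[0, \<infinity>]\<close>.
\<close>

definition loss1 ::
    "nat \<Rightarrow> ((nat \<Rightarrow> 'a::euclidean_space) \<Rightarrow> real) \<Rightarrow>
     (nat \<Rightarrow> real \<Rightarrow> (nat \<Rightarrow> 'a) \<Rightarrow> (nat \<Rightarrow> 'a) \<Rightarrow> real) \<Rightarrow>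
     (nat \<Rightarrow> real \<Rightarrow> (nat \<Rightarrow> 'a) \<Rightarrow> (nat \<Rightarrow> 'a) \<Rightarrow> nat \<Rightarrow> 'a) \<Rightarrow>
     nat \<Rightarrow> real \<Rightarrow> (nat \<Rightarrow> 'a) \<Rightarrow> ennreal" where
  "loss1 T p q M t s x =
     (\<integral>\<^sup>+y. ennreal (block_sqnorm {1..t}
              (\<lambda>i. M t s y (condition t x) i - score {1..t} (diffused_density T p q t s x) y i))
        \<partial>density (block_space {1..t}) (\<lambda>y. ennreal (diffused_density T p q t s x y)))"

definition loss2 ::
    "nat \<Rightarrow> ((nat \<Rightarrow> 'a::euclidean_space) \<Rightarrow> real) \<Rightarrow>
     (nat \<Rightarrow> real \<Rightarrow> (nat \<Rightarrow> 'a) \<Rightarrow> (nat \<Rightarrow> 'a) \<Rightarrow> real) \<Rightarrow>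
     (nat \<Rightarrow> real \<Rightarrow> (nat \<Rightarrow> 'a) \<Rightarrow> (nat \<Rightarrow> 'a) \<Rightarrow> nat \<Rightarrow> 'a) \<Rightarrow>
     nat \<Rightarrow> real \<Rightarrow> (nat \<Rightarrow> 'a) \<Rightarrow> ennreal" where
  "loss2 T p q M t s x =
     (\<integral>\<^sup>+v. (let x' = restrict (x(t := v)) {1..t} in
        \<integral>\<^sup>+y. ennreal (block_sqnorm {1..t}
                 (\<lambda>i. M t s y (condition t x) i - score {1..t} (q t s x') y i))
          \<partial>density (block_space {1..t}) (\<lambda>y. ennreal (q t s x' y)))
        \<partial>density lborel (\<lambda>v. ennreal (next_density T p t x v)))"

text \<open>
  The law of the time series. It is completed because conditional densities are meaningful only
  up to null sets of the condition, so a loss need only agree almost everywhere with a Borel function.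
\<close>

definition series_law :: "nat \<Rightarrow> ((nat \<Rightarrow> 'a::euclidean_space) \<Rightarrow> real) \<Rightarrow> (nat \<Rightarrow> 'a) measure" where
  "series_law T p = completion (density (block_space {1..T}) (\<lambda>x. ennreal (p x)))"

definition objective ::
    "nat \<Rightarrow> ((nat \<Rightarrow> 'a::euclidean_space) \<Rightarrow> real) \<Rightarrow> (real \<Rightarrow> real) \<Rightarrow>
     (nat \<Rightarrow> real \<Rightarrow> (nat \<Rightarrow> 'a) \<Rightarrow> ennreal) \<Rightarrow> real" where
  "objective T p lam l =
     (LINT s:{0..1}|lborel. LINT x|series_law T p. (\<Sum>t\<in>{1..T}. lam s * enn2real (l t s x)))"

text \<open>Absolute convergence of the expectation that defines the objective; the weight may change sign.\<close>

definition objective_converges ::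
    "nat \<Rightarrow> ((nat \<Rightarrow> 'a::euclidean_space) \<Rightarrow> real) \<Rightarrow> (real \<Rightarrow> real) \<Rightarrow>
     (nat \<Rightarrow> real \<Rightarrow> (nat \<Rightarrow> 'a) \<Rightarrow> ennreal) \<Rightarrow> bool" where
  "objective_converges T p lam l \<longleftrightarrow>
     (\<integral>\<^sup>+s\<in>{0..1}. (\<integral>\<^sup>+x. (\<Sum>t\<in>{1..T}. ennreal \<bar>lam s\<bar> * l t s x) \<partial>series_law T p) \<partial>lborel) < \<infinity>"

end

theory Submission
  imports Defs
begin

text \<open>
  Fix \<open>t\<close>, \<open>s\<close> and the condition \<open>x\<^sub>1, \<dots>, x\<^bsub>t-1\<^esub>\<close>. The diffused density is the mixture \<open>r = \<integral> \<pi>(v) k(v, \<cdot>) dv\<close>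
  of the Gaussian kernels \<open>k(v, \<cdot>)\<close> over the conditional density \<open>\<pi>\<close> of \<open>x\<^sub>t = v\<close>. Differentiating under
  the integral gives \<open>r \<nabla> log r = \<integral> \<pi>(v) k(v, \<cdot>) \<nabla> log k(v, \<cdot>) dv\<close>, i.e. \<open>\<nabla> log r(y)\<close> is the conditional
  mean of \<open>\<nabla> log k(v, y)\<close> given \<open>y\<close>. By the bias-variance decomposition the denoising loss of a network
  is therefore its score matching loss plus the denoising loss of the network \<open>\<nabla> log r\<close>. The latter
  term does not involve the parameter and is finite because the Gaussian score has bounded second moment.
\<close>

section \<open>Differentiation and integration\<close>

text \<open>Two obstacles shape the proof. The first is domination: differentiating under the
  integral over \<open>v\<close> needs a bound on the kernel gradient that is uniform in
  \<open>v\<close>, whatever the conditional law of \<open>v\<close> is. Such a bound exists because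
  only the mean of the Gaussian, not its covariance, depends on the clean block, and because
  expressions like \<open>E * exp (- E / 2)\<close> absorb the growth of the score. The second is
  that conditional densities make sense only almost everywhere and that \<open>score\<close> is
  given by a description. Identities are therefore proved at regular conditions, and objectives are
  compared through jointly measurable versions of the losses. Since losses may be infinite,
  subtraction is delicate: the term free of the parameter has to be finite at each regular
  condition, which lets it cancel and lets a measurable version of the score matching loss be
  obtained as a difference. Step 0, where the kernel has no density, is a null set and is removed
  from the integrals.\<close>

lemma GDERIV_unique:
  assumes "GDERIV f x :> D" "GDERIV f x :> E"
  shows "D = E"
proof -
  have "(\<lambda>h. h \<bullet> D) = (\<lambda>h. h \<bullet> E)"
    using assms unfolding gderiv_def by (rule has_derivative_unique)
  then show ?thesis
    by (metis inner_commute vector_eq_ldot)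
qed

lemma score_eqI:
  assumes "i \<in> I" and D: "GDERIV (\<lambda>w. ln (f (y(i := w)))) (y i) :> D"
  shows "score I f y i = D"
proof -
  have "(THE E. GDERIV (\<lambda>w. ln (f (y(i := w)))) (y i) :> E) = D"
    using D GDERIV_unique by (intro the_equality) blast+
  then show ?thesis using assms(1) by (simp add: score_def)
qed

text \<open>The mean value inequality turns the gradient bound \<open>B\<close> into a Lipschitz
  bound for \<open>k v\<close>, so the first-order remainder divided by \<open>norm h\<close> is at
  most \<open>2 * B\<close>. On a finite measure this constant is an integrable majorant. The
  derivative is tested along sequences because dominated convergence is a statement about
  sequences.\<close>

lemma GDERIV_integral:
  fixes k :: "'v \<Rightarrow> 'a::euclidean_space \<Rightarrow> real"
  assumes "finite_measure Q"
    and int: "\<And>w. integrable Q (\<lambda>v. k v w)"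
    and der: "\<And>v w. v \<in> space Q \<Longrightarrow> GDERIV (k v) w :> G v w"
    and bd: "\<And>v w. v \<in> space Q \<Longrightarrow> norm (G v w) \<le> B"
    and meas: "\<And>w. (\<lambda>v. G v w) \<in> borel_measurable Q"
  shows "GDERIV (\<lambda>w. \<integral>v. k v w \<partial>Q) w :> (\<integral>v. G v w \<partial>Q)"
proof -
  interpret finite_measure Q by fact
  have intG: "integrable Q (\<lambda>v. G v w)"
    by (rule integrable_const_bound[where B = B]) (use bd meas in auto)
  have lip: "\<bar>k v (w + h) - k v w\<bar> \<le> B * norm h" if v: "v \<in> space Q" for v h
  proof -
    have "onorm (\<lambda>h. h \<bullet> G v u) \<le> B" for u
      by (rule onorm_le) (metis Cauchy_Schwarz_ineq2 bd[OF v] mult.commute mult_left_mono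
          norm_ge_zero order_trans real_norm_def)
    then have "norm (k v (w + h) - k v w) \<le> B * norm (w + h - w)"
      using der[OF v] unfolding gderiv_def
      by (intro differentiable_bound[where S = UNIV]) auto
    then show ?thesis by simp
  qed
  show ?thesis
    unfolding gderiv_def has_derivative_at tendsto_at_iff_sequentially
  proof (intro conjI allI impI)
    show "bounded_linear (\<lambda>h. h \<bullet> (\<integral>v. G v w \<partial>Q))"
      by (rule bounded_linear_inner_left)
    fix h :: "nat \<Rightarrow> 'a"
    assume "\<forall>n. h n \<in> UNIV - {0}" and h: "h \<longlonglongrightarrow> 0"
    then have h0: "h n \<noteq> 0" for n by auto
    let ?R = "\<lambda>n v. (k v (w + h n) - k v w - h n \<bullet> G v w) / norm (h n)"
    have "(\<lambda>n. \<integral>v. ?R n v \<partial>Q) \<longlonglongrightarrow> (\<integral>v. 0 \<partial>Q)"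
    proof (rule integral_dominated_convergence[where w = "\<lambda>_. 2 * B"])
      show "AE v in Q. (\<lambda>n. ?R n v) \<longlonglongrightarrow> 0"
      proof (rule AE_I2)
        fix v assume "v \<in> space Q"
        from der[OF this, of w]
        have "(\<lambda>h. norm (k v (w + h) - k v w - h \<bullet> G v w) / norm h) \<midarrow>0\<rightarrow> 0"
          unfolding gderiv_def has_derivative_at by blast
        then have "(\<lambda>n. \<bar>?R n v\<bar>) \<longlonglongrightarrow> 0"
          using h h0 unfolding tendsto_at_iff_sequentially by (force simp: o_def)
        then show "(\<lambda>n. ?R n v) \<longlonglongrightarrow> 0" by (rule tendsto_rabs_zero_cancel)
      qed
      show "AE v in Q. norm (?R n v) \<le> 2 * B" for n
      proof (rule AE_I2)
        fix v assume v: "v \<in> space Q"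
        have "\<bar>h n \<bullet> G v w\<bar> \<le> B * norm (h n)"
          by (metis Cauchy_Schwarz_ineq2 bd[OF v] mult.commute mult_left_mono
              norm_ge_zero order_trans)
        then have "\<bar>k v (w + h n) - k v w - h n \<bullet> G v w\<bar> \<le> (2 * B) * norm (h n)"
          using lip[OF v, of "h n"] by linarith
        then show "norm (?R n v) \<le> 2 * B"
          using h0[of n] by (simp add: abs_divide pos_divide_le_eq)
      qed
    qed (use int meas in \<open>auto intro!: borel_measurable_divide borel_measurable_diff borel_measurable_inner\<close>)
    then have "(\<lambda>n. \<bar>\<integral>v. ?R n v \<partial>Q\<bar>) \<longlonglongrightarrow> 0"
      using tendsto_rabs_zero by fastforce
    also have "(\<lambda>n. \<bar>\<integral>v. ?R n v \<partial>Q\<bar>) = (\<lambda>n. \<bar>(\<integral>v. k v (w + h n) \<partial>Q) - (\<integral>v. k v w \<partial>Q)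
        - h n \<bullet> (\<integral>v. G v w \<partial>Q)\<bar> / norm (h n))"
      using int intG by (simp add: abs_divide)
    finally show "((\<lambda>h. norm ((\<integral>v. k v (w + h) \<partial>Q) - (\<integral>v. k v w \<partial>Q)
        - h \<bullet> (\<integral>v. G v w \<partial>Q)) / norm h) \<circ> h) \<longlonglongrightarrow> 0"
      by (simp add: o_def)
  qed
qed

text \<open>Expanding the square around an arbitrary point \<open>b\<close> expresses the weighted
  integral through three fixed integrals. Comparing \<open>b = a\<close> with \<open>b = S\<close>
  leaves the squared distance of \<open>a\<close> to the weighted mean \<open>S\<close>, since the
  cross term vanishes. The three integrals are finite, so the comparison takes place in the reals
  before returning to \<open>ennreal\<close>.\<close>

lemma nn_integral_weighted_variance:
  fixes \<sigma> :: "'v \<Rightarrow> 'a::euclidean_space"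
  assumes k: "integrable Q k" and ks: "integrable Q (\<lambda>v. k v *\<^sub>R \<sigma> v)"
    and kss: "integrable Q (\<lambda>v. k v * (norm (\<sigma> v))\<^sup>2)"
    and pos: "\<And>v. v \<in> space Q \<Longrightarrow> 0 \<le> k v"
    and mean: "(\<integral>v. k v *\<^sub>R \<sigma> v \<partial>Q) = (\<integral>v. k v \<partial>Q) *\<^sub>R S"
  shows "(\<integral>\<^sup>+v. ennreal (k v * (norm (a - \<sigma> v))\<^sup>2) \<partial>Q) =
    ennreal ((\<integral>v. k v \<partial>Q) * (norm (a - S))\<^sup>2) + (\<integral>\<^sup>+v. ennreal (k v * (norm (\<sigma> v - S))\<^sup>2) \<partial>Q)"
proof -
  \<comment> \<open>The weight stays inside the inner product, where \<open>ks\<close> and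
    \<open>mean\<close> speak about it.\<close>
  have sq: "k v * (norm (b - \<sigma> v))\<^sup>2 =
      k v * (norm b)\<^sup>2 - 2 * (b \<bullet> (k v *\<^sub>R \<sigma> v)) + k v * (norm (\<sigma> v))\<^sup>2" for b v
    by (simp add: power2_norm_eq_inner inner_diff_left inner_diff_right inner_commute algebra_simps)
  have int: "integrable Q (\<lambda>v. k v * (norm (b - \<sigma> v))\<^sup>2)" for b
    unfolding sq using k ks kss by (simp del: inner_scaleR_right)
  have val: "(\<integral>v. k v * (norm (b - \<sigma> v))\<^sup>2 \<partial>Q) = (\<integral>v. k v \<partial>Q) * (norm b)\<^sup>2
      - 2 * (b \<bullet> ((\<integral>v. k v \<partial>Q) *\<^sub>R S)) + (\<integral>v. k v * (norm (\<sigma> v))\<^sup>2 \<partial>Q)" for b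
    unfolding sq mean[symmetric] using k ks kss by (simp del: inner_scaleR_right)
  have eq: "(\<integral>v. k v * (norm (a - \<sigma> v))\<^sup>2 \<partial>Q) =
      (\<integral>v. k v \<partial>Q) * (norm (a - S))\<^sup>2 + (\<integral>v. k v * (norm (S - \<sigma> v))\<^sup>2 \<partial>Q)"
    unfolding val
    by (simp add: power2_norm_eq_inner inner_diff_left inner_diff_right inner_commute algebra_simps)
  have nn: "(\<integral>\<^sup>+v. ennreal (k v * (norm (b - \<sigma> v))\<^sup>2) \<partial>Q) =
      ennreal (\<integral>v. k v * (norm (b - \<sigma> v))\<^sup>2 \<partial>Q)" for b
    by (rule nn_integral_eq_integral[OF int]) (use pos in auto)
  have "0 \<le> (\<integral>v. k v \<partial>Q)" "0 \<le> (\<integral>v. k v * (norm (S - \<sigma> v))\<^sup>2 \<partial>Q)"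
    using pos by (auto intro!: integral_nonneg_AE)
  then show ?thesis
    unfolding norm_minus_commute[of _ S] nn eq by simp
qed

section \<open>Translation invariance of Lebesgue measure on blocks\<close>

lemma product_sigma_finite_lborel: "product_sigma_finite (\<lambda>_. lborel)"
  by standard

lemma measurable_block_translate:
  assumes "i \<in> I"
  shows "(\<lambda>y. y(i := y i + c)) \<in> measurable (block_space I) (block_space I)"
  using assms by (intro measurable_fun_upd[where J = I]) auto

text \<open>Tonelli isolates coordinate \<open>i\<close>, where Lebesgue measure is translation
  invariant. It is used to see that a translate of the density \<open>q x\<close> still has mass
  one.\<close>

lemma nn_integral_block_space_translate:
  fixes f :: "(nat \<Rightarrow> 'a::euclidean_space) \<Rightarrow> ennreal"
  assumes I: "finite I" "i \<in> I" and [measurable]: "f \<in> borel_measurable (block_space I)"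
  shows "(\<integral>\<^sup>+y. f (y(i := y i + c)) \<partial>block_space I) = (\<integral>\<^sup>+y. f y \<partial>block_space I)"
proof -
  interpret product_sigma_finite "\<lambda>_::nat. lborel :: 'a measure"
    by (rule product_sigma_finite_lborel)
  define J where "J = I - {i}"
  have J: "I = insert i J" "finite J" "i \<notin> J" using I by (auto simp: J_def)
  have [measurable]: "f \<in> borel_measurable (block_space (insert i J))"
    using assms(3) unfolding J(1) .
  have upd: "(\<lambda>y. y(i := y i + c)) \<in> measurable (block_space (insert i J)) (block_space (insert i J))"
    by (rule measurable_block_translate) simp
  have "(\<integral>\<^sup>+y. f (y(i := y i + c)) \<partial>block_space I) =
      (\<integral>\<^sup>+x. (\<integral>\<^sup>+w. f (x(i := w + c)) \<partial>lborel) \<partial>block_space J)"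
    unfolding J(1) using measurable_compose[OF upd assms(3)[unfolded J(1)]] J
    by (subst product_nn_integral_insert) auto
  also have "\<dots> = (\<integral>\<^sup>+x. (\<integral>\<^sup>+w. f (x(i := w)) \<partial>lborel) \<partial>block_space J)"
  proof (rule nn_integral_cong)
    fix x :: "nat \<Rightarrow> 'a" assume x: "x \<in> space (block_space J)"
    have [measurable]: "(\<lambda>w. f (x(i := w))) \<in> borel_measurable lborel"
      using measurable_compose[OF measurable_component_update[OF x J(3)] assms(3)[unfolded J(1)]]
      by simp
    have "(\<integral>\<^sup>+w. f (x(i := w)) \<partial>lborel) = (\<integral>\<^sup>+w. f (x(i := w)) \<partial>distr lborel borel ((+) c))"
      by (simp add: lborel_distr_plus)
    also have "\<dots> = (\<integral>\<^sup>+w. f (x(i := w + c)) \<partial>lborel)"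
      by (subst nn_integral_distr) (auto simp: add.commute)
    finally show "(\<integral>\<^sup>+w. f (x(i := w + c)) \<partial>lborel) = (\<integral>\<^sup>+w. f (x(i := w)) \<partial>lborel)" ..
  qed
  also have "\<dots> = (\<integral>\<^sup>+y. f y \<partial>block_space I)"
    unfolding J(1) using J by (subst product_nn_integral_insert) auto
  finally show ?thesis .
qed

section \<open>Gaussian transition kernels\<close>

text \<open>At the deviation from the mean this is the squared Mahalanobis distance; the exponent in
  \<open>gaussian_transition\<close> is minus half of it.\<close>

definition block_quad :: "nat set \<Rightarrow> (nat \<Rightarrow> nat \<Rightarrow> 'a::euclidean_space \<Rightarrow>\<^sub>L 'a) \<Rightarrow> (nat \<Rightarrow> 'a) \<Rightarrow> real" where
  "block_quad I P z = block_inner I z (block_apply I P z)"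

text \<open>The symmetry in \<open>block_pos_def\<close> merges the two cross terms. The expansion
  serves three purposes: its linear term gives the gradient, its nonnegativity bounds
  \<open>block_apply\<close>, and completing the square with it produces translates of the
  Gaussian.\<close>

lemma block_quad_update:
  assumes I: "finite I" "i \<in> I" and P: "block_pos_def I P"
  shows "block_quad I P (z(i := z i + h)) =
    block_quad I P z + 2 * (h \<bullet> block_apply I P z i) + h \<bullet> P i i h"
proof -
  define e where "e = (\<lambda>j. if j = i then h else 0)"
  have z: "z(i := z i + h) = (\<lambda>j. z j + e j)"
    by (auto simp: e_def)
  have lin: "block_apply I P (\<lambda>j. z j + e j) = (\<lambda>j. block_apply I P z j + block_apply I P e j)"
    by (auto simp: block_apply_def blinfun.add_right sum.distrib)
  have inner_e: "block_inner I e u = h \<bullet> u i" for u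
  proof -
    have "block_inner I e u = (\<Sum>j\<in>I. if j = i then h \<bullet> u i else 0)"
      unfolding block_inner_def e_def by (rule sum.cong) auto
    then show ?thesis using I by simp
  qed
  have apply_e: "block_apply I P e i = P i i h"
  proof -
    have "block_apply I P e i = (\<Sum>j\<in>I. if j = i then P i i h else 0)"
      unfolding block_apply_def e_def by (rule sum.cong) auto
    then show ?thesis using I by simp
  qed
  have "block_inner I z (block_apply I P e) = block_inner I (block_apply I P z) e"
    using P by (auto simp: block_pos_def_def)
  also have "\<dots> = block_inner I e (block_apply I P z)"
    by (simp add: block_inner_def inner_commute)
  finally have sym: "block_inner I z (block_apply I P e) = h \<bullet> block_apply I P z i"
    by (simp add: inner_e)
  have "block_quad I P (\<lambda>j. z j + e j) =
      block_inner I z (block_apply I P z) + block_inner I z (block_apply I P e)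
      + (block_inner I e (block_apply I P z) + block_inner I e (block_apply I P e))"
    unfolding block_quad_def lin
    by (simp add: block_inner_def inner_add_left inner_add_right sum.distrib)
  then show ?thesis
    unfolding z sym inner_e apply_e by (simp add: block_quad_def)
qed

lemma block_quad_nonneg:
  assumes "block_pos_def I P"
  shows "0 \<le> block_quad I P z"
proof (cases "\<exists>i\<in>I. z i \<noteq> 0")
  case True
  then show ?thesis using assms by (auto simp: block_pos_def_def block_quad_def intro: less_imp_le)
qed (simp add: block_quad_def block_inner_def)

text \<open>The quadratic form is nonnegative at \<open>z - r (P z)\<^sub>i e\<^sub>i\<close>, where \<open>r = 1 / (\<parallel>P\<^sub>i\<^sub>i\<parallel> + 1)\<close>.\<close>

lemma norm_block_apply_le:
  assumes I: "finite I" "i \<in> I" and P: "block_pos_def I P"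
  shows "(norm (block_apply I P z i))\<^sup>2 \<le> (norm (P i i) + 1) * block_quad I P z"
proof -
  define b where "b = block_apply I P z i"
  \<comment> \<open>The summand 1 keeps \<open>C\<close> positive whatever \<open>P i i\<close> is.
    For \<open>r = 1 / C\<close> the two correction terms below combine to
    \<open>- (norm b)\<^sup>2 / C\<close>.\<close>
  define C where "C = norm (P i i) + 1"
  have C: "C > 0" by (simp add: C_def add_nonneg_pos)
  let ?r = "1 / C"
  have "b \<bullet> P i i b \<le> norm b * norm (P i i b)"
    by (rule norm_cauchy_schwarz)
  also have "\<dots> \<le> norm b * (norm (P i i) * norm b)"
    by (intro mult_left_mono norm_blinfun) auto
  also have "\<dots> \<le> C * (norm b)\<^sup>2"
    by (simp add: C_def power2_eq_square algebra_simps)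
  finally have bb: "?r\<^sup>2 * (b \<bullet> P i i b) \<le> ?r\<^sup>2 * (C * (norm b)\<^sup>2)"
    by (rule mult_left_mono) simp
  have "0 \<le> block_quad I P (z(i := z i + (- ?r) *\<^sub>R b))"
    by (rule block_quad_nonneg[OF P])
  also have "\<dots> = block_quad I P z - 2 * ?r * (norm b)\<^sup>2 + ?r\<^sup>2 * (b \<bullet> P i i b)"
    unfolding block_quad_update[OF I P] b_def[symmetric]
    by (simp add: blinfun.scaleR_right blinfun.minus_right dot_square_norm power2_eq_square)
  also have "\<dots> \<le> block_quad I P z - 2 * ?r * (norm b)\<^sup>2 + ?r\<^sup>2 * (C * (norm b)\<^sup>2)"
    using bb by simp
  also have "\<dots> = block_quad I P z - (norm b)\<^sup>2 / C"
    using C by (simp add: power2_eq_square field_simps)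
  finally have "(norm b)\<^sup>2 / C \<le> block_quad I P z" by simp
  then show ?thesis
    using C by (simp add: b_def[symmetric] C_def[symmetric] pos_divide_le_eq mult.commute)
qed

lemma GDERIV_gaussian:
  assumes I: "finite I" "i \<in> I" and P: "block_pos_def I P"
  shows "GDERIV (\<lambda>w. \<kappa> * exp (- block_quad I P (\<lambda>j. (y(i := w)) j - \<mu> j) / 2)) w0 :>
    - (\<kappa> * exp (- block_quad I P (\<lambda>j. (y(i := w0)) j - \<mu> j) / 2)) *\<^sub>R
      block_apply I P (\<lambda>j. (y(i := w0)) j - \<mu> j) i"
proof -
  define z where "z = (\<lambda>j. (y(i := w0)) j - \<mu> j)"
  \<comment> \<open>Writing \<open>w\<close> as an increment from \<open>w0\<close> makes
    \<open>block_quad_update\<close> exhibit a quadratic polynomial in \<open>w - w0\<close>, whose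
    linear part is the derivative.\<close>
  have z: "(\<lambda>j. (y(i := w)) j - \<mu> j) = z(i := z i + (w - w0))" for w
    by (auto simp: z_def)
  have "((\<lambda>w. block_quad I P (z(i := z i + (w - w0)))) has_derivative
      (\<lambda>h. 2 * (h \<bullet> block_apply I P z i))) (at w0)"
    unfolding block_quad_update[OF I P]
    by (auto intro!: derivative_eq_intros bounded_linear.has_derivative[OF blinfun.bounded_linear_right]
        simp: fun_eq_iff)
  then have "((\<lambda>w. \<kappa> * exp (- block_quad I P (z(i := z i + (w - w0))) / 2)) has_derivative
      (\<lambda>h. h \<bullet> (- (\<kappa> * exp (- block_quad I P z / 2)) *\<^sub>R block_apply I P z i))) (at w0)"
    by (auto intro!: derivative_eq_intros simp: fun_eq_iff)
  then show ?thesis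
    unfolding gderiv_def z by simp
qed

text \<open>For nonnegative \<open>u\<close> the quadratic Taylor bound gives
  \<open>u\<^sup>2 / 2 \<le> exp u\<close>; for the other sign the second exponential takes
  over.\<close>

lemma square_le_exp_add_exp: "(u::real)\<^sup>2 \<le> 2 * (exp u + exp (- u))"
proof -
  have pos: "v\<^sup>2 \<le> 2 * exp v" if "v \<ge> 0" for v :: real
    using exp_lower_Taylor_quadratic[OF that] that by simp
  show ?thesis
    using pos[of u] pos[of "- u"] exp_gt_zero[of u] exp_gt_zero[of "- u"]
    by (cases "u \<ge> 0") (auto simp: distrib_left intro: add_increasing add_increasing2)
qed

lemma space_block_space: "space (block_space I) = extensional I"
  by (simp add: space_PiM PiE_def)

text \<open>The constant comes from \<open>E / 2 \<le> exp (E / 2)\<close>. With \<open>E\<close>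
  the quadratic form, this is how the decay of the density absorbs the square of the score.\<close>

lemma mult_exp_minus_half_le: "(E::real) * exp (- E / 2) \<le> 2"
proof -
  have "E / 2 \<le> exp (E / 2)"
    using exp_ge_add_one_self[of "E / 2"] by linarith
  then have "E / 2 * exp (- (E / 2)) \<le> exp (E / 2) * exp (- (E / 2))"
    by (rule mult_right_mono) simp
  also have "\<dots> = 1"
    by (simp add: exp_add[symmetric])
  finally show ?thesis by simp
qed

text \<open>
  The second moment of the score is bounded uniformly in \<open>x\<close> without computing Gaussian integrals:
  \<open>u\<^sup>2 \<le> 2 (e\<^sup>u + e\<^sup>-\<^sup>u)\<close> is applied to the components \<open>u\<close> of the score, and \<open>e\<^sup>\<plusminus>\<^sup>u q x\<close> is a constant
  multiple of a translate of \<open>q x\<close>.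
\<close>

lemma gaussian_transition_score:
  fixes q :: "(nat \<Rightarrow> 'a::euclidean_space) \<Rightarrow> (nat \<Rightarrow> 'a) \<Rightarrow> real"
  assumes I: "finite I" and gauss: "gaussian_transition I q"
    and meas: "\<And>x. x \<in> extensional I \<Longrightarrow> q x \<in> borel_measurable (block_space I)"
    and prob: "\<And>x. x \<in> extensional I \<Longrightarrow> (\<integral>\<^sup>+y. ennreal (q x y) \<partial>block_space I) = 1"
  obtains B where
    "\<And>x y. x \<in> extensional I \<Longrightarrow> y \<in> extensional I \<Longrightarrow> 0 < q x y"
    "\<And>x y. x \<in> extensional I \<Longrightarrow> y \<in> extensional I \<Longrightarrow> q x y \<le> B"
    "\<And>x y i. x \<in> extensional I \<Longrightarrow> y \<in> extensional I \<Longrightarrow> i \<in> I \<Longrightarrow>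
       GDERIV (\<lambda>w. q x (y(i := w))) (y i) :> q x y *\<^sub>R score I (q x) y i"
    "\<And>x y i. x \<in> extensional I \<Longrightarrow> y \<in> extensional I \<Longrightarrow> i \<in> I \<Longrightarrow>
       q x y * norm (score I (q x) y i) \<le> B"
    "\<And>x y i. x \<in> extensional I \<Longrightarrow> y \<in> extensional I \<Longrightarrow> i \<in> I \<Longrightarrow>
       q x y * (norm (score I (q x) y i))\<^sup>2 \<le> B"
    "\<And>x i. x \<in> extensional I \<Longrightarrow> i \<in> I \<Longrightarrow>
       (\<integral>\<^sup>+y. ennreal (q x y * (norm (score I (q x) y i))\<^sup>2) \<partial>block_space I) \<le> ennreal B"
proof -
  obtain m P \<kappa> where P: "block_pos_def I P"
    and q0: "\<And>x y. x \<in> extensional I \<Longrightarrow> y \<in> extensional I \<Longrightarrow>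
      q x y = \<kappa> * exp (- block_quad I P (\<lambda>i. y i - m x i) / 2)"
    using gauss unfolding gaussian_transition_def block_quad_def Let_def by blast
  define b where "b x y i = block_apply I P (\<lambda>j. y j - m x j) i" for x y i
  \<comment> \<open>\<open>gaussian_transition\<close> does not fix the sign of
    \<open>\<kappa>\<close>. If it were not positive, truncation by \<open>ennreal\<close> would
    make the mass 0 instead of 1.\<close>
  have \<kappa>: "\<kappa> > 0"
  proof (rule ccontr)
    assume "\<not> \<kappa> > 0"
    define x :: "nat \<Rightarrow> 'a" where "x = (\<lambda>i\<in>I. 0)"
    have x: "x \<in> extensional I" by (simp add: x_def)
    have "(\<integral>\<^sup>+y. ennreal (q x y) \<partial>block_space I) = (\<integral>\<^sup>+y. 0 \<partial>(block_space I :: (nat \<Rightarrow> 'a) measure))"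
      using \<open>\<not> \<kappa> > 0\<close>
      by (intro nn_integral_cong)
        (auto simp: space_block_space q0[OF x] ennreal_eq_0_iff mult_nonpos_nonneg)
    then show False using prob[OF x] by simp
  qed
  have qpos: "0 < q x y" if "x \<in> extensional I" "y \<in> extensional I" for x y
    using \<kappa> by (simp add: q0[OF that])
  have qle: "q x y \<le> \<kappa>" if "x \<in> extensional I" "y \<in> extensional I" for x y
    using \<kappa> block_quad_nonneg[OF P, of "\<lambda>i. y i - m x i"] by (simp add: q0[OF that])
  have upd: "y(i := w) \<in> extensional I" if "y \<in> extensional I" "i \<in> I" for y :: "nat \<Rightarrow> 'a" and i w
    using that by (auto simp: extensional_def)
  have grad: "GDERIV (\<lambda>w. q x (y(i := w))) (y i) :> - q x y *\<^sub>R b x y i"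
    if x: "x \<in> extensional I" and y: "y \<in> extensional I" and i: "i \<in> I" for x y i
    using GDERIV_gaussian[OF I i P, of \<kappa> y "m x" "y i"]
    unfolding q0[OF x upd[OF y i]] q0[OF x y] b_def by simp
  have sc: "score I (q x) y i = - b x y i"
    if x: "x \<in> extensional I" and y: "y \<in> extensional I" and i: "i \<in> I" for x y i
  proof -
    have "GDERIV (\<lambda>w. ln (q x (y(i := w)))) (y i) :> inverse (q x y) *\<^sub>R (- q x y *\<^sub>R b x y i)"
      by (rule GDERIV_DERIV_compose[OF grad[OF x y i]])
        (use qpos[OF x y] in \<open>auto intro!: DERIV_ln\<close>)
    then have "GDERIV (\<lambda>w. ln (q x (y(i := w)))) (y i) :> - b x y i"
      using qpos[OF x y] by simp
    then show ?thesis by (rule score_eqI[OF i])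
  qed
  \<comment> \<open>One constant for all coordinates. It depends on \<open>P\<close> only, so the
    bounds below are uniform in the clean block \<open>x\<close>.\<close>
  define C where "C = (\<Sum>i\<in>I. norm (P i i) + 1)"
  have C0: "C \<ge> 0" unfolding C_def by (intro sum_nonneg) auto
  have sq: "q x y * (norm (b x y i))\<^sup>2 \<le> 2 * \<kappa> * C"
    if x: "x \<in> extensional I" and y: "y \<in> extensional I" and i: "i \<in> I" for x y i
  proof -
    let ?E = "block_quad I P (\<lambda>j. y j - m x j)"
    have E: "?E \<ge> 0" by (rule block_quad_nonneg[OF P])
    have "(norm (b x y i))\<^sup>2 \<le> (norm (P i i) + 1) * ?E"
      unfolding b_def by (rule norm_block_apply_le[OF I i P])
    also have "\<dots> \<le> C * ?E"
      unfolding C_def using E I i by (intro mult_right_mono member_le_sum) auto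
    finally have "q x y * (norm (b x y i))\<^sup>2 \<le> q x y * (C * ?E)"
      using qpos[OF x y] by simp
    also have "\<dots> = \<kappa> * C * (?E * exp (- ?E / 2))"
      by (simp add: q0[OF x y])
    also have "\<dots> \<le> \<kappa> * C * 2"
      using \<kappa> C0 by (intro mult_left_mono mult_exp_minus_half_le) auto
    finally show ?thesis by simp
  qed
  have lin: "q x y * norm (b x y i) \<le> \<kappa> + 2 * \<kappa> * C"
    if x: "x \<in> extensional I" and y: "y \<in> extensional I" and i: "i \<in> I" for x y i
  proof -
    \<comment> \<open>A bound on the squared score controls the score itself; the inequality is a
      weakening of \<open>(n - 1 / 2)\<^sup>2 \<ge> 0\<close>.\<close>
    have "n \<le> 1 + n\<^sup>2" for n :: real
      using zero_le_power2[of "n - 1 / 2"] by (simp add: power2_eq_square algebra_simps)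
    then have "norm (b x y i) \<le> 1 + (norm (b x y i))\<^sup>2" .
    then have "q x y * norm (b x y i) \<le> q x y * (1 + (norm (b x y i))\<^sup>2)"
      using qpos[OF x y] by simp
    also have "\<dots> \<le> \<kappa> + 2 * \<kappa> * C"
      using qle[OF x y] sq[OF x y i] by (simp add: distrib_left)
    finally show ?thesis .
  qed
  \<comment> \<open>Completing the square: \<open>exp (\<beta> \<bullet> P i i \<beta> / 2)\<close>
    is the factor by which tilting with \<open>exp (\<beta> \<bullet> b x y i)\<close> rescales the
    translated density, and the 2 is the constant of \<open>square_le_exp_add_exp\<close>.\<close>
  define a where "a i \<beta> = 2 * exp (\<beta> \<bullet> P i i \<beta> / 2)" for i \<beta>
  have a0: "a i \<beta> \<ge> 0" for i \<beta> by (simp add: a_def)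
  have tilt: "2 * (q x y * exp (\<beta> \<bullet> b x y i)) = a i \<beta> * q x (y(i := y i + - \<beta>))"
    if x: "x \<in> extensional I" and y: "y \<in> extensional I" and i: "i \<in> I" for x y i \<beta>
  proof -
    have *: "(\<lambda>j. (y(i := y i + - \<beta>)) j - m x j) = (\<lambda>j. y j - m x j)(i := y i - m x i + - \<beta>)"
      by auto
    show ?thesis
      unfolding q0[OF x y] q0[OF x upd[OF y i]] * block_quad_update[OF I i P, of "\<lambda>j. y j - m x j"]
        b_def a_def
      by (simp add: blinfun.minus_right exp_add[symmetric] field_simps)
  qed
  have am: "a i (- \<beta>) = a i \<beta>" for i \<beta>
    by (simp add: a_def blinfun.minus_right)
  \<comment> \<open>Each basis vector contributes two translates, one per sign. Both have mass one
    and the same factor \<open>a i \<beta>\<close>, hence the 2.\<close>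
  define D where "D i = (\<Sum>\<beta>\<in>Basis. 2 * a i \<beta>)" for i
  have D0: "D i \<ge> 0" for i unfolding D_def by (intro sum_nonneg) (simp add: a0)
  have moment: "(\<integral>\<^sup>+y. ennreal (q x y * (norm (b x y i))\<^sup>2) \<partial>block_space I) \<le> ennreal (D i)"
    if x: "x \<in> extensional I" and i: "i \<in> I" for x i
  proof -
    have [measurable]: "q x \<in> borel_measurable (block_space I)" by (rule meas[OF x])
    have [measurable]: "(\<lambda>y. q x (y(i := y i + c))) \<in> borel_measurable (block_space I)" for c
      by (rule measurable_compose[OF measurable_block_translate[OF i]]) simp
    have mass: "(\<integral>\<^sup>+y. ennreal (q x (y(i := y i + c))) \<partial>block_space I) = 1" for c
      using nn_integral_block_space_translate[OF I i, of "\<lambda>y. ennreal (q x y)" c] prob[OF x]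
      by simp
    have "(\<integral>\<^sup>+y. ennreal (q x y * (norm (b x y i))\<^sup>2) \<partial>block_space I) \<le>
      (\<integral>\<^sup>+y. (\<Sum>\<beta>\<in>Basis. ennreal (a i \<beta>) * (ennreal (q x (y(i := y i + - \<beta>))) +
        ennreal (q x (y(i := y i + \<beta>))))) \<partial>block_space I)"
    proof (rule nn_integral_mono)
      fix y :: "nat \<Rightarrow> 'a" assume "y \<in> space (block_space I)"
      then have y: "y \<in> extensional I" by (simp add: space_block_space)
      have "q x y * (norm (b x y i))\<^sup>2 = (\<Sum>\<beta>\<in>Basis. q x y * (\<beta> \<bullet> b x y i)\<^sup>2)"
        by (subst power2_norm_eq_inner, subst euclidean_inner)
          (simp add: sum_distrib_left power2_eq_square inner_commute)
      also have "\<dots> \<le> (\<Sum>\<beta>\<in>Basis. q x y * (2 * (exp (\<beta> \<bullet> b x y i) + exp (- \<beta> \<bullet> b x y i))))"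
        using qpos[OF x y] square_le_exp_add_exp by (intro sum_mono mult_left_mono) auto
      also have "\<dots> = (\<Sum>\<beta>\<in>Basis. a i \<beta> * (q x (y(i := y i + - \<beta>)) + q x (y(i := y i + \<beta>))))"
        using tilt[OF x y i] tilt[OF x y i, of "- \<beta>" for \<beta>] am
        by (intro sum.cong) (auto simp: algebra_simps)
      finally have "ennreal (q x y * (norm (b x y i))\<^sup>2) \<le> ennreal \<dots>"
        by (rule ennreal_leI)
      also have "\<dots> = (\<Sum>\<beta>\<in>Basis. ennreal (a i \<beta>) * (ennreal (q x (y(i := y i + - \<beta>))) +
          ennreal (q x (y(i := y i + \<beta>)))))"
        using a0 qpos[OF x upd[OF y i]]
        by (subst sum_ennreal[symmetric])
          (auto simp: ennreal_mult' less_imp_le intro!: mult_nonneg_nonneg add_nonneg_nonneg sum.cong)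
      finally show "ennreal (q x y * (norm (b x y i))\<^sup>2) \<le> \<dots>" .
    qed
    also have "\<dots> = (\<Sum>\<beta>\<in>Basis. ennreal (a i \<beta>) * (1 + 1))"
      by (subst nn_integral_sum) (auto simp: nn_integral_cmult nn_integral_add mass
          simp del: add_uminus_conv_diff)
    also have "\<dots> = ennreal (D i)"
      unfolding D_def using a0
      by (subst sum_ennreal[symmetric]) (auto simp: ennreal_mult' mult.commute intro!: sum.cong)
    finally show ?thesis .
  qed
  \<comment> \<open>A single constant above the bound for the density, the two pointwise bounds for
    the score and every second moment \<open>D i\<close>.\<close>
  define B where "B = \<kappa> + 2 * \<kappa> * C + (\<Sum>i\<in>I. D i)"
  have B: "\<kappa> + 2 * \<kappa> * C \<le> B" "2 * \<kappa> * C \<le> B" "\<kappa> \<le> B"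
    using \<kappa> C0 sum_nonneg[of I D] D0 by (auto simp: B_def)
  have DB: "D i \<le> B" if "i \<in> I" for i
    using member_le_sum[OF that, of D] D0 I \<kappa> C0 by (auto simp: B_def intro: add_increasing)
  show ?thesis
  proof (rule that[of B])
    fix x y :: "nat \<Rightarrow> 'a" assume x: "x \<in> extensional I" and y: "y \<in> extensional I"
    show "q x y \<le> B"
      using qle[OF x y] B by linarith
  next
    fix x y :: "nat \<Rightarrow> 'a" and i assume x: "x \<in> extensional I" and i: "i \<in> I"
    have "(\<integral>\<^sup>+y. ennreal (q x y * (norm (score I (q x) y i))\<^sup>2) \<partial>block_space I)
      = (\<integral>\<^sup>+y. ennreal (q x y * (norm (b x y i))\<^sup>2) \<partial>block_space I)"
      by (rule nn_integral_cong) (simp add: space_block_space sc[OF x _ i])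
    also have "\<dots> \<le> ennreal B"
      using moment[OF x i] DB[OF i] by (meson ennreal_leI order_trans)
    finally show "(\<integral>\<^sup>+y. ennreal (q x y * (norm (score I (q x) y i))\<^sup>2) \<partial>block_space I) \<le> ennreal B" .
    assume y: "y \<in> extensional I"
    show "GDERIV (\<lambda>w. q x (y(i := w))) (y i) :> q x y *\<^sub>R score I (q x) y i"
      using grad[OF x y i] by (simp add: sc[OF x y i])
    show "q x y * norm (score I (q x) y i) \<le> B"
      using lin[OF x y i] B by (simp add: sc[OF x y i])
    show "q x y * (norm (score I (q x) y i))\<^sup>2 \<le> B"
      using sq[OF x y i] B by (simp add: sc[OF x y i])
  qed (use qpos in auto)
qed

section \<open>Mixtures of kernels\<close>

lemma sigma_finite_block_space: "finite I \<Longrightarrow> sigma_finite_measure (block_space I)"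
proof -
  assume "finite I"
  interpret finite_product_sigma_finite "\<lambda>_. lborel" I
    by (simp add: finite_product_sigma_finite_def finite_product_sigma_finite_axioms_def
        product_sigma_finite_lborel \<open>finite I\<close>)
  show ?thesis by (rule sigma_finite_measure_axioms)
qed

text \<open>This isolates what the argument takes from the Gaussian kernel. \<open>Q\<close> stands
  for the law of the next observation given the condition, and \<open>\<sigma> v\<close> for the
  score of \<open>k v\<close>. The pointwise bounds justify differentiation under the integral and
  the variance identity at fixed \<open>y\<close>; the bound on the moment integrated over
  \<open>y\<close> gives a finite constant term.\<close>

locale score_mixture = prob_space Q for Q :: "'v measure" +
  fixes I :: "nat set" and k :: "'v \<Rightarrow> (nat \<Rightarrow> 'a::euclidean_space) \<Rightarrow> real"
    and \<sigma> :: "'v \<Rightarrow> (nat \<Rightarrow> 'a) \<Rightarrow> nat \<Rightarrow> 'a" and B :: real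
  assumes fin: "finite I"
    and k_measurable [measurable]: "(\<lambda>(v, y). k v y) \<in> borel_measurable (Q \<Otimes>\<^sub>M block_space I)"
    and \<sigma>_measurable [measurable]:
      "\<And>i. i \<in> I \<Longrightarrow> (\<lambda>(v, y). \<sigma> v y i) \<in> borel_measurable (Q \<Otimes>\<^sub>M block_space I)"
    and k_pos: "\<And>v y. v \<in> space Q \<Longrightarrow> y \<in> extensional I \<Longrightarrow> 0 < k v y"
    and k_le: "\<And>v y. v \<in> space Q \<Longrightarrow> y \<in> extensional I \<Longrightarrow> k v y \<le> B"
    and k_grad: "\<And>v y i. v \<in> space Q \<Longrightarrow> y \<in> extensional I \<Longrightarrow> i \<in> I \<Longrightarrow>
       GDERIV (\<lambda>w. k v (y(i := w))) (y i) :> k v y *\<^sub>R \<sigma> v y i"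
    and k_grad_le: "\<And>v y i. v \<in> space Q \<Longrightarrow> y \<in> extensional I \<Longrightarrow> i \<in> I \<Longrightarrow>
       k v y * norm (\<sigma> v y i) \<le> B"
    and k_sq_le: "\<And>v y i. v \<in> space Q \<Longrightarrow> y \<in> extensional I \<Longrightarrow> i \<in> I \<Longrightarrow>
       k v y * (norm (\<sigma> v y i))\<^sup>2 \<le> B"
    and k_moment: "\<And>v i. v \<in> space Q \<Longrightarrow> i \<in> I \<Longrightarrow>
       (\<integral>\<^sup>+y. ennreal (k v y * (norm (\<sigma> v y i))\<^sup>2) \<partial>block_space I) \<le> ennreal B"
begin

definition mix :: "(nat \<Rightarrow> 'a) \<Rightarrow> real" where
  "mix y = (\<integral>v. k v y \<partial>Q)"

definition mix_score :: "(nat \<Rightarrow> 'a) \<Rightarrow> nat \<Rightarrow> 'a" where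
  "mix_score y i = (1 / mix y) *\<^sub>R (\<integral>v. k v y *\<^sub>R \<sigma> v y i \<partial>Q)"

lemma ext_space: "y \<in> extensional I \<longleftrightarrow> y \<in> space (block_space I)"
  by (simp add: space_block_space)

lemma measurable_k: "y \<in> extensional I \<Longrightarrow> (\<lambda>v. k v y) \<in> borel_measurable Q"
  using measurable_compose[OF measurable_Pair2' k_measurable, of y] by (simp add: ext_space)

lemma measurable_\<sigma>: "y \<in> extensional I \<Longrightarrow> i \<in> I \<Longrightarrow> (\<lambda>v. \<sigma> v y i) \<in> borel_measurable Q"
  using measurable_compose[OF measurable_Pair2' \<sigma>_measurable, of y] by (simp add: ext_space)

lemma measurable_k2: "v \<in> space Q \<Longrightarrow> k v \<in> borel_measurable (block_space I)"
  using measurable_compose[OF measurable_Pair1' k_measurable, of v] by simp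

lemma measurable_\<sigma>2: "v \<in> space Q \<Longrightarrow> i \<in> I \<Longrightarrow> (\<lambda>y. \<sigma> v y i) \<in> borel_measurable (block_space I)"
  using measurable_compose[OF measurable_Pair1' \<sigma>_measurable, of v] by simp

lemma integrable_k: "y \<in> extensional I \<Longrightarrow> integrable Q (\<lambda>v. k v y)"
  using k_le k_pos measurable_k
  by (intro integrable_const_bound[where B = B]) (auto simp: abs_of_pos)

lemma integrable_k_\<sigma>:
  "y \<in> extensional I \<Longrightarrow> i \<in> I \<Longrightarrow> integrable Q (\<lambda>v. k v y *\<^sub>R \<sigma> v y i)"
  using k_grad_le k_pos measurable_k measurable_\<sigma>
  by (intro integrable_const_bound[where B = B]) (auto simp: abs_of_pos)

lemma integrable_k_\<sigma>_sq:
  "y \<in> extensional I \<Longrightarrow> i \<in> I \<Longrightarrow> integrable Q (\<lambda>v. k v y * (norm (\<sigma> v y i))\<^sup>2)"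
  using k_sq_le k_pos measurable_k measurable_\<sigma>
  by (intro integrable_const_bound[where B = B]) (auto simp: abs_of_pos abs_mult)

text \<open>A vanishing integral of a nonnegative function would force \<open>k v y = 0\<close> for
  almost every \<open>v\<close>, which is impossible on a probability space. Strictness is what the
  logarithm and the division in \<open>mix_score\<close> rely on.\<close>

lemma mix_pos:
  assumes y: "y \<in> extensional I"
  shows "0 < mix y"
proof -
  have nn: "AE v in Q. 0 \<le> k v y"
    using k_pos[OF _ y] by (auto intro: less_imp_le)
  have "mix y \<noteq> 0"
  proof
    assume "mix y = 0"
    then have "AE v in Q. k v y = 0"
      using integral_nonneg_eq_0_iff_AE[OF integrable_k[OF y] nn] by (simp add: mix_def)
    then have "AE v in Q. False"
      by (rule AE_mp) (use k_pos[OF _ y] in force)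
    then show False by (simp add: AE_False)
  qed
  moreover have "0 \<le> mix y"
    unfolding mix_def by (rule integral_nonneg_AE[OF nn])
  ultimately show ?thesis by simp
qed

lemma extensional_upd: "y \<in> extensional I \<Longrightarrow> i \<in> I \<Longrightarrow> y(i := w) \<in> extensional I"
  by (auto simp: extensional_def)

lemma score_mix:
  assumes y: "y \<in> extensional I" and i: "i \<in> I"
  shows "score I mix y i = mix_score y i"
proof (rule score_eqI[OF i])
  note upd = extensional_upd[OF y i]
  have "GDERIV (\<lambda>w. \<integral>v. k v (y(i := w)) \<partial>Q) (y i) :>
      (\<integral>v. k v (y(i := y i)) *\<^sub>R \<sigma> v (y(i := y i)) i \<partial>Q)"
  \<comment> \<open>The bound has to hold along the whole line through \<open>y\<close> in
    coordinate \<open>i\<close>. All points \<open>y(i := w)\<close> are extensional again because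
    \<open>i\<close> lies in \<open>I\<close>.\<close>
  proof (rule GDERIV_integral[where B = B])
    fix v w
    show "integrable Q (\<lambda>v. k v (y(i := w)))"
      by (rule integrable_k[OF upd])
    show "(\<lambda>v. k v (y(i := w)) *\<^sub>R \<sigma> v (y(i := w)) i) \<in> borel_measurable Q"
      by (rule borel_measurable_integrable[OF integrable_k_\<sigma>[OF upd i]])
    assume v: "v \<in> space Q"
    show "GDERIV (\<lambda>w. k v (y(i := w))) w :> k v (y(i := w)) *\<^sub>R \<sigma> v (y(i := w)) i"
      using k_grad[OF v upd[of w] i] by simp
    show "norm (k v (y(i := w)) *\<^sub>R \<sigma> v (y(i := w)) i) \<le> B"
      using k_grad_le[OF v upd[of w] i] k_pos[OF v upd[of w]] by (simp add: abs_of_pos)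
  qed (rule finite_measure_axioms)
  then have "GDERIV (\<lambda>w. mix (y(i := w))) (y i) :> (\<integral>v. k v y *\<^sub>R \<sigma> v y i \<partial>Q)"
    by (simp add: mix_def)
  then have "GDERIV (\<lambda>w. ln (mix (y(i := w)))) (y i) :>
      inverse (mix y) *\<^sub>R (\<integral>v. k v y *\<^sub>R \<sigma> v y i \<partial>Q)"
    by (rule GDERIV_DERIV_compose) (use mix_pos[OF y] in \<open>auto intro!: DERIV_ln\<close>)
  then show "GDERIV (\<lambda>w. ln (mix (y(i := w)))) (y i) :> mix_score y i"
    by (simp add: mix_score_def inverse_eq_divide)
qed

lemma measurable_mix [measurable]: "mix \<in> borel_measurable (block_space I)"
  unfolding mix_def by measurable

lemma measurable_mix_score [measurable]:
  "i \<in> I \<Longrightarrow> (\<lambda>y. mix_score y i) \<in> borel_measurable (block_space I)"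
  unfolding mix_score_def by measurable

text \<open>Written in the same form as \<open>loss2\<close>, including the \<open>density\<close>
  measure inside, so that \<open>loss2\<close> at a regular condition is literally an
  instance.\<close>

definition kernel_loss :: "((nat \<Rightarrow> 'a) \<Rightarrow> nat \<Rightarrow> 'a) \<Rightarrow> ennreal" where
  "kernel_loss m = (\<integral>\<^sup>+v. \<integral>\<^sup>+y. ennreal (block_sqnorm I (\<lambda>i. m y i - \<sigma> v y i))
     \<partial>density (block_space I) (\<lambda>y. ennreal (k v y)) \<partial>Q)"

lemma kernel_loss_eq_sum:
  assumes [measurable]: "\<And>i. i \<in> I \<Longrightarrow> (\<lambda>y. m y i) \<in> borel_measurable (block_space I)"
  shows "kernel_loss m =
    (\<integral>\<^sup>+v. \<integral>\<^sup>+y. (\<Sum>i\<in>I. ennreal (k v y * (norm (m y i - \<sigma> v y i))\<^sup>2)) \<partial>block_space I \<partial>Q)"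
  unfolding kernel_loss_def
proof (rule nn_integral_cong)
  fix v assume v: "v \<in> space Q"
  note [measurable] = measurable_k2[OF v] measurable_\<sigma>2[OF v]
  have "(\<integral>\<^sup>+y. ennreal (block_sqnorm I (\<lambda>i. m y i - \<sigma> v y i))
      \<partial>density (block_space I) (\<lambda>y. ennreal (k v y))) =
    (\<integral>\<^sup>+y. ennreal (k v y) * ennreal (block_sqnorm I (\<lambda>i. m y i - \<sigma> v y i)) \<partial>block_space I)"
    unfolding block_sqnorm_def by (rule nn_integral_density) measurable
  also have "\<dots> = (\<integral>\<^sup>+y. (\<Sum>i\<in>I. ennreal (k v y * (norm (m y i - \<sigma> v y i))\<^sup>2)) \<partial>block_space I)"
    using k_pos[OF v] fin
    by (intro nn_integral_cong)
      (auto simp: block_sqnorm_def space_block_space sum_ennreal sum_distrib_left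
        ennreal_mult'[symmetric] less_imp_le sum_nonneg)
  finally show "(\<integral>\<^sup>+y. ennreal (block_sqnorm I (\<lambda>i. m y i - \<sigma> v y i))
      \<partial>density (block_space I) (\<lambda>y. ennreal (k v y))) = \<dots>" .
qed

text \<open>Tonelli brings the integral over \<open>v\<close> to the inside, so that the variance
  identity can be applied at a fixed \<open>y\<close> and a fixed coordinate.\<close>

lemma kernel_loss_eq_sum':
  assumes m[measurable]: "\<And>i. i \<in> I \<Longrightarrow> (\<lambda>y. m y i) \<in> borel_measurable (block_space I)"
  shows "kernel_loss m =
    (\<integral>\<^sup>+y. (\<Sum>i\<in>I. \<integral>\<^sup>+v. ennreal (k v y * (norm (m y i - \<sigma> v y i))\<^sup>2) \<partial>Q) \<partial>block_space I)"
proof -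
  interpret L: sigma_finite_measure "block_space I :: (nat \<Rightarrow> 'a) measure"
    by (rule sigma_finite_block_space[OF fin])
  interpret P: pair_sigma_finite Q "block_space I :: (nat \<Rightarrow> 'a) measure" ..
  have "kernel_loss m =
      (\<integral>\<^sup>+v. \<integral>\<^sup>+y. (\<Sum>i\<in>I. ennreal (k v y * (norm (m y i - \<sigma> v y i))\<^sup>2)) \<partial>block_space I \<partial>Q)"
    by (rule kernel_loss_eq_sum) (rule m)
  also have "\<dots> =
      (\<integral>\<^sup>+y. \<integral>\<^sup>+v. (\<Sum>i\<in>I. ennreal (k v y * (norm (m y i - \<sigma> v y i))\<^sup>2)) \<partial>Q \<partial>block_space I)"
    by (rule P.Fubini'[symmetric]) measurable
  also have "\<dots> =
      (\<integral>\<^sup>+y. (\<Sum>i\<in>I. \<integral>\<^sup>+v. ennreal (k v y * (norm (m y i - \<sigma> v y i))\<^sup>2) \<partial>Q) \<partial>block_space I)"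
    using measurable_k measurable_\<sigma>
    by (intro nn_integral_cong nn_integral_sum) (auto simp: space_block_space)
  finally show ?thesis .
qed

text \<open>The variance identity holds for each \<open>y\<close> and each coordinate. All terms are
  nonnegative, so it can be summed and integrated in \<open>ennreal\<close> even if the loss of
  \<open>m\<close> is infinite.\<close>

lemma kernel_loss_decomposition:
  assumes m[measurable]: "\<And>i. i \<in> I \<Longrightarrow> (\<lambda>y. m y i) \<in> borel_measurable (block_space I)"
  shows "kernel_loss m =
    (\<integral>\<^sup>+y. ennreal (block_sqnorm I (\<lambda>i. m y i - score I mix y i))
       \<partial>density (block_space I) (\<lambda>y. ennreal (mix y))) + kernel_loss (score I mix)"
proof -
  \<comment> \<open>Measurability is invisible in the description that defines \<open>score\<close>;
    it comes from the integral formula \<open>mix_score\<close>.\<close>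
  have sm[measurable]: "(\<lambda>y. score I mix y i) \<in> borel_measurable (block_space I)" if "i \<in> I" for i
    using that by (subst measurable_cong[OF score_mix]) (auto simp: space_block_space)
  have split: "(\<integral>\<^sup>+v. ennreal (k v y * (norm (m y i - \<sigma> v y i))\<^sup>2) \<partial>Q) =
      ennreal (mix y * (norm (m y i - score I mix y i))\<^sup>2) +
      (\<integral>\<^sup>+v. ennreal (k v y * (norm (score I mix y i - \<sigma> v y i))\<^sup>2) \<partial>Q)"
    if y: "y \<in> extensional I" and i: "i \<in> I" for y i
    unfolding score_mix[OF y i] norm_minus_commute[of "mix_score y i"] mix_def
    by (rule nn_integral_weighted_variance)
      (use integrable_k integrable_k_\<sigma> integrable_k_\<sigma>_sq y i k_pos mix_pos[OF y] in
        \<open>auto intro: less_imp_le simp: mix_score_def mix_def\<close>)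
  have "kernel_loss m =
      (\<integral>\<^sup>+y. (\<Sum>i\<in>I. ennreal (mix y * (norm (m y i - score I mix y i))\<^sup>2)) +
        (\<Sum>i\<in>I. \<integral>\<^sup>+v. ennreal (k v y * (norm (score I mix y i - \<sigma> v y i))\<^sup>2) \<partial>Q) \<partial>block_space I)"
    by (subst kernel_loss_eq_sum', rule m, assumption, rule nn_integral_cong) (simp add: split space_block_space sum.distrib)
  also have "\<dots> = (\<integral>\<^sup>+y. (\<Sum>i\<in>I. ennreal (mix y * (norm (m y i - score I mix y i))\<^sup>2)) \<partial>block_space I)
      + kernel_loss (score I mix)"
    by (subst kernel_loss_eq_sum', rule sm, assumption, rule nn_integral_add) measurable
  also have "(\<integral>\<^sup>+y. (\<Sum>i\<in>I. ennreal (mix y * (norm (m y i - score I mix y i))\<^sup>2)) \<partial>block_space I) =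
      (\<integral>\<^sup>+y. ennreal (mix y) * ennreal (block_sqnorm I (\<lambda>i. m y i - score I mix y i)) \<partial>block_space I)"
    using mix_pos by (intro nn_integral_cong)
      (auto simp: block_sqnorm_def space_block_space sum_ennreal sum_distrib_left
        ennreal_mult'[symmetric] less_imp_le sum_nonneg)
  also have "\<dots> = (\<integral>\<^sup>+y. ennreal (block_sqnorm I (\<lambda>i. m y i - score I mix y i))
       \<partial>density (block_space I) (\<lambda>y. ennreal (mix y)))"
    unfolding block_sqnorm_def by (rule nn_integral_density[symmetric]) measurable
  finally show ?thesis .
qed

text \<open>The decomposition shows that no measurable network beats the exact score. Comparison
  with the zero network bounds its loss by the second moment of the kernel scores.\<close>

lemma kernel_loss_score_finite: "kernel_loss (score I mix) < \<infinity>"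
proof -
  have "kernel_loss (score I mix) \<le> kernel_loss (\<lambda>_ _. 0)"
    by (subst (2) kernel_loss_decomposition) auto
  also have "\<dots> \<le> (\<integral>\<^sup>+v. (\<Sum>i\<in>I. ennreal B) \<partial>Q)"
  proof (subst kernel_loss_eq_sum, simp, rule nn_integral_mono)
    fix v assume v: "v \<in> space Q"
    note [measurable] = measurable_k2[OF v] measurable_\<sigma>2[OF v]
    show "(\<integral>\<^sup>+y. (\<Sum>i\<in>I. ennreal (k v y * (norm (0 - \<sigma> v y i))\<^sup>2)) \<partial>block_space I)
        \<le> (\<Sum>i\<in>I. ennreal B)"
      by (subst nn_integral_sum) (auto intro!: sum_mono k_moment[OF v] simp del: sum_constant)
  qed
  also have "\<dots> < \<infinity>"
    by (simp add: emeasure_space_1 ennreal_mult_less_top of_nat_less_top)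
  finally show ?thesis .
qed

end

section \<open>Marginal densities\<close>

text \<open>\<open>score\<close> inspects only points that differ from \<open>y\<close> in a
  coordinate of \<open>I\<close>, and these are extensional again. This matters because densities
  will be compared only on the space of the block measure.\<close>

lemma score_cong:
  assumes y: "y \<in> extensional I" and eq: "\<And>z. z \<in> extensional I \<Longrightarrow> f z = g z"
  shows "score I f y = score I g y"
proof -
  have "f (y(i := v)) = g (y(i := v))" if "i \<in> I" for i v
    using that y by (intro eq) (auto simp: extensional_def)
  then show ?thesis unfolding score_def by (intro restrict_ext) simp
qed

lemma marginal_cong:
  assumes "\<And>i. i \<in> {1..t} \<Longrightarrow> x i = x' i"
  shows "marginal T p t x = marginal T p t x'"
proof -
  have "merge {1..t} {Suc t..T} (x, z) = merge {1..t} {Suc t..T} (x', z)" for z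
    using assms by (auto simp: merge_def fun_eq_iff)
  then show ?thesis by (simp add: marginal_def)
qed

locale series_density =
  fixes T :: nat and p :: "(nat \<Rightarrow> 'a::euclidean_space) \<Rightarrow> real"
  assumes p_measurable [measurable]: "p \<in> borel_measurable (block_space {1..T})"
    and p_nonneg: "\<And>x. p x \<ge> 0"
    and p_prob: "prob_space (density (block_space {1..T}) (\<lambda>x. ennreal (p x)))"
begin

abbreviation law :: "(nat \<Rightarrow> 'a) measure" where
  "law \<equiv> density (block_space {1..T}) (\<lambda>x. ennreal (p x))"

text \<open>The nonnegative integral makes Tonelli available without integrability and keeps the
  value infinity visible, which the Bochner integral in \<open>marginal\<close> turns into
  0.\<close>

definition nn_marginal :: "nat \<Rightarrow> (nat \<Rightarrow> 'a) \<Rightarrow> ennreal" where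
  "nn_marginal t x =
     (\<integral>\<^sup>+z. ennreal (p (merge {1..t} {Suc t..T} (x, z))) \<partial>block_space {Suc t..T})"

lemma measurable_merge_block:
  assumes "t \<le> T" "\<And>i. i \<in> {1..t} \<Longrightarrow> (\<lambda>\<omega>. f \<omega> i) \<in> borel_measurable N"
    "\<And>i. i \<in> {Suc t..T} \<Longrightarrow> (\<lambda>\<omega>. h \<omega> i) \<in> borel_measurable N"
  shows "(\<lambda>\<omega>. merge {1..t} {Suc t..T} (f \<omega>, h \<omega>)) \<in> measurable N (block_space {1..T})"
proof -
  have "merge {1..t} {Suc t..T} (f \<omega>, h \<omega>) = (\<lambda>i\<in>{1..T}. if i \<in> {1..t} then f \<omega> i else h \<omega> i)" for \<omega>
    using assms(1) by (auto simp: merge_def fun_eq_iff)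
  moreover have "(\<lambda>\<omega>. if i \<in> {1..t} then f \<omega> i else h \<omega> i) \<in> borel_measurable N" if "i \<in> {1..T}" for i
    using assms(2,3)[of i] that by (cases "i \<in> {1..t}") auto
  then have "(\<lambda>\<omega>. \<lambda>i\<in>{1..T}. if i \<in> {1..t} then f \<omega> i else h \<omega> i) \<in> measurable N (block_space {1..T})"
    by (intro measurable_restrict) (simp add: measurable_lborel1)
  ultimately show ?thesis by simp
qed

lemma measurable_nn_marginal:
  assumes t: "t \<le> T" and f: "\<And>i. i \<in> {1..t} \<Longrightarrow> (\<lambda>\<omega>. f \<omega> i) \<in> borel_measurable N"
  shows "(\<lambda>\<omega>. nn_marginal t (f \<omega>)) \<in> borel_measurable N"
proof -
  interpret sigma_finite_measure "block_space {Suc t..T} :: (nat \<Rightarrow> 'a) measure"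
    by (rule sigma_finite_block_space) simp
  have [measurable]: "(\<lambda>\<omega>. merge {1..t} {Suc t..T} (f (fst \<omega>), snd \<omega>))
      \<in> measurable (N \<Otimes>\<^sub>M block_space {Suc t..T}) (block_space {1..T})"
    by (rule measurable_merge_block[OF t]) (auto intro: measurable_compose[OF measurable_fst f])
  have "(\<lambda>\<omega>. ennreal (p (merge {1..t} {Suc t..T} (f (fst \<omega>), snd \<omega>))))
      \<in> borel_measurable (N \<Otimes>\<^sub>M block_space {Suc t..T})"
    by measurable
  then show ?thesis
    unfolding nn_marginal_def by (intro borel_measurable_nn_integral) (simp add: split_beta')
qed

lemma marginal_eq: "t \<le> T \<Longrightarrow> marginal T p t x = enn2real (nn_marginal t x)"
proof -
  assume t: "t \<le> T"
  have [measurable]: "(\<lambda>z. merge {1..t} {Suc t..T} (x, z))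
      \<in> measurable (block_space {Suc t..T}) (block_space {1..T})"
    by (rule measurable_merge_block[OF t]) auto
  have "(\<lambda>z. p (merge {1..t} {Suc t..T} (x, z))) \<in> borel_measurable (block_space {Suc t..T})"
    by measurable
  then show ?thesis
    unfolding marginal_def nn_marginal_def using p_nonneg
    by (intro integral_eq_nn_integral) simp_all
qed

lemma measurable_marginal:
  assumes "t \<le> T" "\<And>i. i \<in> {1..t} \<Longrightarrow> (\<lambda>\<omega>. f \<omega> i) \<in> borel_measurable N"
  shows "(\<lambda>\<omega>. marginal T p t (f \<omega>)) \<in> borel_measurable N"
  using measurable_nn_marginal[of t f N, OF assms] by (simp add: marginal_eq[OF assms(1)])

lemma marginal_nonneg: "0 \<le> marginal T p t x"
  unfolding marginal_def using p_nonneg by (intro integral_nonneg_AE) simp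

text \<open>Tonelli splits coordinate \<open>t\<close> off the block of future observations. For
  \<open>t = 1\<close> the known block is empty, and the left side is the total mass of
  \<open>p\<close>.\<close>

lemma nn_marginal_pred:
  assumes t: "t \<in> {1..T}"
  shows "nn_marginal (t - 1) x = (\<integral>\<^sup>+v. nn_marginal t (x(t := v)) \<partial>lborel)"
proof -
  interpret product_sigma_finite "\<lambda>_::nat. lborel :: 'a measure"
    by (rule product_sigma_finite_lborel)
  define F where "F z = ennreal (p (merge {1..t - 1} {Suc (t - 1)..T} (x, z)))" for z
  have set: "{Suc (t - 1)..T} = insert t {Suc t..T}" using t by auto
  have "(\<lambda>z. merge {1..t - 1} {Suc (t - 1)..T} (x, z))
      \<in> measurable (block_space {Suc (t - 1)..T}) (block_space {1..T})"
    by (rule measurable_merge_block) (use t in auto)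
  then have "F \<in> borel_measurable (block_space {Suc (t - 1)..T})"
    unfolding F_def by measurable
  then have F: "F \<in> borel_measurable (block_space (insert t {Suc t..T}))"
    unfolding set .
  have "nn_marginal (t - 1) x = (\<integral>\<^sup>+z. F z \<partial>block_space {Suc (t - 1)..T})"
    unfolding nn_marginal_def F_def by (rule refl)
  also have "\<dots> = (\<integral>\<^sup>+v. \<integral>\<^sup>+z. F (z(t := v)) \<partial>block_space {Suc t..T} \<partial>lborel)"
    unfolding set by (rule product_nn_integral_insert_rev[OF _ _ F]) auto
  finally have "nn_marginal (t - 1) x =
      (\<integral>\<^sup>+v. \<integral>\<^sup>+z. F (z(t := v)) \<partial>block_space {Suc t..T} \<partial>lborel)" .
  moreover have "merge {1..t - 1} {Suc (t - 1)..T} (x, z(t := v)) =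
      merge {1..t} {Suc t..T} (x(t := v), z)" for z v
    using t by (auto simp: merge_def fun_eq_iff)
  ultimately show ?thesis by (simp only: nn_marginal_def F_def)
qed

text \<open>The first \<open>t\<close> observations have density \<open>nn_marginal t\<close>. The
  set where this density is 0 carries no mass, and the set where it is infinite is Lebesgue null
  because the integral is 1.\<close>

lemma AE_nn_marginal:
  assumes t: "t \<le> T"
  shows "AE x in law. 0 < nn_marginal t x \<and> nn_marginal t x < \<infinity>"
proof -
  interpret product_sigma_finite "\<lambda>_::nat. lborel :: 'a measure"
    by (rule product_sigma_finite_lborel)
  interpret P: prob_space law by (rule p_prob)
  let ?I = "{1..t}" and ?J = "{Suc t..T}"
  have IJ: "?I \<union> ?J = {1..T}" "?I \<inter> ?J = {}" using t by auto
  have [measurable]: "nn_marginal t \<in> borel_measurable (block_space {1..T})"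
    using measurable_nn_marginal[OF t, of "\<lambda>x. x" "block_space {1..T}"] t by simp
  have I[measurable]: "nn_marginal t \<in> borel_measurable (block_space ?I)"
    using measurable_nn_marginal[OF t, of "\<lambda>x. x" "block_space ?I"] by simp
  \<comment> \<open>Integrating out the future replaces \<open>p\<close> by its marginal in front of
    a function of the marginal. The choice \<open>h = 1\<close> yields the total mass; the indicator
    of \<open>{0, \<infinity>}\<close> yields the mass of the exceptional set.\<close>
  have fold: "(\<integral>\<^sup>+x. ennreal (p x) * h (nn_marginal t x) \<partial>block_space {1..T}) =
      (\<integral>\<^sup>+x. nn_marginal t x * h (nn_marginal t x) \<partial>block_space ?I)"
    if [measurable]: "h \<in> borel_measurable borel" for h :: "ennreal \<Rightarrow> ennreal"
  proof -
    have Fm: "(\<lambda>x. ennreal (p x) * h (nn_marginal t x)) \<in> borel_measurable (block_space (?I \<union> ?J))"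
      unfolding IJ(1) by measurable
    have "(\<integral>\<^sup>+x. ennreal (p x) * h (nn_marginal t x) \<partial>block_space {1..T}) =
      (\<integral>\<^sup>+x. \<integral>\<^sup>+z. ennreal (p (merge ?I ?J (x, z))) * h (nn_marginal t (merge ?I ?J (x, z)))
        \<partial>block_space ?J \<partial>block_space ?I)"
      using product_nn_integral_fold[OF IJ(2) _ _ Fm] unfolding IJ(1) by simp
    also have "\<dots> = (\<integral>\<^sup>+x. \<integral>\<^sup>+z. ennreal (p (merge ?I ?J (x, z))) * h (nn_marginal t x)
        \<partial>block_space ?J \<partial>block_space ?I)"
    proof -
      have "merge ?I ?J (merge ?I ?J (x, z), w) = merge ?I ?J (x, w)" for x z w :: "nat \<Rightarrow> 'a"
        by (auto simp: merge_def fun_eq_iff)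
      then show ?thesis by (simp add: nn_marginal_def)
    qed
    also have "\<dots> = (\<integral>\<^sup>+x. nn_marginal t x * h (nn_marginal t x) \<partial>block_space ?I)"
    proof (rule nn_integral_cong)
      fix x :: "nat \<Rightarrow> 'a"
      have [measurable]: "(\<lambda>z. merge ?I ?J (x, z)) \<in> measurable (block_space ?J) (block_space {1..T})"
        by (rule measurable_merge_block[OF t]) auto
      have "(\<lambda>z. ennreal (p (merge ?I ?J (x, z)))) \<in> borel_measurable (block_space ?J)"
        by measurable
      then show "(\<integral>\<^sup>+z. ennreal (p (merge ?I ?J (x, z))) * h (nn_marginal t x) \<partial>block_space ?J) =
          nn_marginal t x * h (nn_marginal t x)"
        by (subst nn_integral_multc) (simp_all only: nn_marginal_def)
    qed
    finally show ?thesis .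
  qed
  have [measurable]: "{0, \<infinity> :: ennreal} \<in> sets borel" by simp
  have Im: "(\<lambda>x. nn_marginal t x * indicator {0, \<infinity>} (nn_marginal t x)) \<in> borel_measurable (block_space ?I)"
    and Tm: "(\<lambda>x. ennreal (p x) * indicator {0, \<infinity>} (nn_marginal t x)) \<in> borel_measurable (block_space {1..T})"
    by measurable
  have pm: "(\<lambda>x. ennreal (p x)) \<in> borel_measurable (block_space {1..T})"
    by measurable
  have "emeasure law (space law) = (\<integral>\<^sup>+x. ennreal (p x) \<partial>block_space {1..T})"
    unfolding space_density by (subst emeasure_density[OF pm sets.top]) (auto intro!: nn_integral_cong)
  then have "(\<integral>\<^sup>+x. nn_marginal t x \<partial>block_space ?I) = 1"
    using fold[OF borel_measurable_const, of 1] P.emeasure_space_1 by (simp only: mult_1_right)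
  then have "(\<integral>\<^sup>+x. nn_marginal t x \<partial>block_space ?I) \<noteq> \<infinity>"
    by simp
  then have "AE x in block_space ?I. nn_marginal t x \<noteq> \<infinity>"
    by (intro nn_integral_PInf_AE I)
  then have "AE x in block_space ?I. nn_marginal t x * indicator {0, \<infinity>} (nn_marginal t x) = 0"
    by eventually_elim (auto split: split_indicator)
  then have "(\<integral>\<^sup>+x. nn_marginal t x * indicator {0, \<infinity>} (nn_marginal t x) \<partial>block_space ?I) = 0"
    by (simp only: nn_integral_0_iff_AE[OF Im])
  then have "(\<integral>\<^sup>+x. ennreal (p x) * indicator {0, \<infinity>} (nn_marginal t x) \<partial>block_space {1..T}) = 0"
    using fold[of "indicator {0, \<infinity>}"] by (simp only: borel_measurable_indicator \<open>{0, \<infinity>} \<in> sets borel\<close>)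
  then have "AE x in block_space {1..T}. ennreal (p x) * indicator {0, \<infinity>} (nn_marginal t x) = 0"
    by (simp only: nn_integral_0_iff_AE[OF Tm])
  then show ?thesis
    unfolding AE_density[OF pm] by eventually_elim
      (auto simp: indicator_def less_top zero_less_iff_neq_zero split: if_splits)
qed

text \<open>For irregular \<open>x\<close> the divisor in \<open>next_density\<close> is a junk value \<open>0\<close> of \<open>marginal\<close>.\<close>

definition regular :: "nat \<Rightarrow> (nat \<Rightarrow> 'a) \<Rightarrow> bool" where
  "regular t x \<longleftrightarrow> 0 < nn_marginal (t - 1) x \<and> nn_marginal (t - 1) x < \<infinity>"

lemma AE_regular: "AE x in law. \<forall>t\<in>{1..T}. regular t x"
proof (rule AE_finite_allI)
  fix t assume "t \<in> {1..T}"
  then show "AE x in law. regular t x"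
    unfolding regular_def by (intro AE_nn_marginal) auto
qed simp

lemma next_density_nonneg: "0 \<le> next_density T p t x v"
  by (simp add: next_density_def marginal_nonneg)

lemma measurable_next_density:
  assumes t: "t \<in> {1..T}"
  shows "(\<lambda>(x, v). next_density T p t x v) \<in> borel_measurable (block_space {1..T} \<Otimes>\<^sub>M lborel)"
proof -
  have "(\<lambda>\<omega>. marginal T p t ((fst \<omega>)(t := snd \<omega>))) \<in> borel_measurable (block_space {1..T} \<Otimes>\<^sub>M lborel)"
    using t by (intro measurable_marginal) (auto simp: fun_upd_def)
  moreover have "(\<lambda>\<omega>. marginal T p (t - 1) (fst \<omega>)) \<in> borel_measurable (block_space {1..T} \<Otimes>\<^sub>M lborel)"
    using t by (intro measurable_marginal) auto
  ultimately show ?thesis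
    unfolding next_density_def split_beta' by (rule borel_measurable_divide)
qed

lemma measurable_next_density': "t \<in> {1..T} \<Longrightarrow> next_density T p t x \<in> borel_measurable lborel"
  unfolding next_density_def
  by (intro borel_measurable_divide measurable_marginal) (auto simp: fun_upd_def)

text \<open>By \<open>nn_marginal_pred\<close> the numerators integrate to the denominator
  \<open>Z\<close>, and regularity makes \<open>Z / Z\<close> equal to 1. The numerator can be
  infinite, hence 0 in \<open>marginal\<close>, only on a null set of \<open>v\<close>, because
  \<open>Z\<close> is finite.\<close>

lemma prob_space_next:
  assumes t: "t \<in> {1..T}" and x: "regular t x"
  shows "prob_space (density lborel (\<lambda>v. ennreal (next_density T p t x v)))"
proof
  define Z where "Z = nn_marginal (t - 1) x"
  have Z: "0 < Z" "Z < \<infinity>" using x by (auto simp: regular_def Z_def)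
  have m: "marginal T p (t - 1) x = enn2real Z"
    using t by (subst marginal_eq) (auto simp: Z_def)
  have [measurable]: "(\<lambda>v. nn_marginal t (x(t := v))) \<in> borel_measurable lborel"
    using t by (intro measurable_nn_marginal) (auto simp: fun_upd_def)
  have "(\<integral>\<^sup>+v. nn_marginal t (x(t := v)) \<partial>lborel) \<noteq> \<infinity>"
    using Z nn_marginal_pred[OF t, of x] by (auto simp: Z_def)
  then have ae: "AE v in lborel. nn_marginal t (x(t := v)) \<noteq> \<infinity>"
    by (intro nn_integral_PInf_AE) auto
  have "(\<integral>\<^sup>+v. ennreal (next_density T p t x v) \<partial>lborel) =
      (\<integral>\<^sup>+v. nn_marginal t (x(t := v)) / Z \<partial>lborel)"
  proof (rule nn_integral_cong_AE, use ae in eventually_elim)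
    fix v assume fin: "nn_marginal t (x(t := v)) \<noteq> \<infinity>"
    have "0 < enn2real Z"
      using Z by (simp add: enn2real_positive_iff)
    then have "ennreal (next_density T p t x v) =
        ennreal (enn2real (nn_marginal t (x(t := v)))) / ennreal (enn2real Z)"
      unfolding next_density_def m using t
      by (subst marginal_eq) (simp_all only: divide_ennreal enn2real_nonneg atLeastAtMost_iff)
    then show "ennreal (next_density T p t x v) = nn_marginal t (x(t := v)) / Z"
      using fin Z by (simp add: less_top)
  qed
  also have "\<dots> = Z / Z"
    using nn_marginal_pred[OF t, of x] by (simp add: nn_integral_divide Z_def)
  also have "\<dots> = 1"
    using Z by (intro ennreal_divide_self) auto
  finally show "emeasure (density lborel (\<lambda>v. ennreal (next_density T p t x v)))
      (space (density lborel (\<lambda>v. ennreal (next_density T p t x v)))) = 1"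
    using measurable_next_density'[OF t, of x] by (subst emeasure_density) auto
qed

end

section \<open>Losses\<close>

text \<open>A component of the gradient as the limit of countably many difference quotients, a form
  in which measurability passes to the limit.\<close>

lemma LIMSEQ_GDERIV:
  assumes "GDERIV f x :> D"
  shows "(\<lambda>n. (f (x + inverse (real (Suc n)) *\<^sub>R b) - f x) / inverse (real (Suc n))) \<longlonglongrightarrow> b \<bullet> D"
proof -
  have "(f has_derivative (\<lambda>h. h \<bullet> D)) (at (x + 0 *\<^sub>R b))"
    using assms by (simp add: gderiv_def)
  moreover have "((\<lambda>r. x + r *\<^sub>R b) has_derivative (\<lambda>r. r *\<^sub>R b)) (at 0)"
    by (auto intro!: derivative_eq_intros)
  ultimately have "((\<lambda>r. f (x + r *\<^sub>R b)) has_derivative (\<lambda>r. (r *\<^sub>R b) \<bullet> D)) (at 0)"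
    using has_derivative_compose by blast
  then have "((\<lambda>r. f (x + r *\<^sub>R b)) has_field_derivative b \<bullet> D) (at 0)"
    by (simp add: has_field_derivative_def mult_commute_abs)
  then have "(\<lambda>r. (f (x + r *\<^sub>R b) - f x) / r) \<midarrow>0\<rightarrow> b \<bullet> D"
    by (simp add: DERIV_def)
  moreover have "filterlim (\<lambda>n. inverse (real (Suc n))) (at 0) sequentially"
    using LIMSEQ_inverse_real_of_nat by (intro filterlim_atI) auto
  ultimately show ?thesis by (rule filterlim_compose)
qed

text \<open>Step 0 is excluded: there the sample is still clean, and its law given the clean block
  is a point mass.\<close>

abbreviation (input) steps :: "real measure" where
  "steps \<equiv> restrict_space borel {0<..1}"

lemma space_steps: "space steps = {0<..1}"
  by (simp add: space_restrict_space)

locale diffused_series = series_density T p for T and p :: "(nat \<Rightarrow> 'a::euclidean_space) \<Rightarrow> real" +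
  fixes q :: "nat \<Rightarrow> real \<Rightarrow> (nat \<Rightarrow> 'a) \<Rightarrow> (nat \<Rightarrow> 'a) \<Rightarrow> real"
  assumes q_gaussian: "\<And>t s. t \<in> {1..T} \<Longrightarrow> s \<in> {0<..1} \<Longrightarrow> gaussian_transition {1..t} (q t s)"
    and q_measurable: "\<And>t. t \<in> {1..T} \<Longrightarrow>
      (\<lambda>(s, x, y). q t s x y) \<in> borel_measurable (steps \<Otimes>\<^sub>M block_space {1..t} \<Otimes>\<^sub>M block_space {1..t})"
    and q_prob: "\<And>t s x. t \<in> {1..T} \<Longrightarrow> s \<in> {0<..1} \<Longrightarrow> x \<in> extensional {1..t} \<Longrightarrow>
      (\<integral>\<^sup>+y. ennreal (q t s x y) \<partial>block_space {1..t}) = 1"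
begin

abbreviation extend :: "nat \<Rightarrow> (nat \<Rightarrow> 'a) \<Rightarrow> 'a \<Rightarrow> nat \<Rightarrow> 'a" where
  "extend t x v \<equiv> restrict (x(t := v)) {1..t}"

abbreviation kscore :: "nat \<Rightarrow> real \<Rightarrow> (nat \<Rightarrow> 'a) \<Rightarrow> (nat \<Rightarrow> 'a) \<Rightarrow> nat \<Rightarrow> 'a" where
  "kscore t s x y \<equiv> score {1..t} (q t s x) y"

section \<open>Joint measurability of the kernel and its score\<close>

lemma measurable_q:
  assumes "t \<in> {1..T}" "S \<in> measurable N steps" "X \<in> measurable N (block_space {1..t})"
    "Y \<in> measurable N (block_space {1..t})"
  shows "(\<lambda>\<omega>. q t (S \<omega>) (X \<omega>) (Y \<omega>)) \<in> borel_measurable N"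
  using measurable_compose[OF measurable_Pair[OF assms(2) measurable_Pair[OF assms(3,4)]]
      q_measurable[OF assms(1)]] by simp

lemma measurable_q_last: "t \<in> {1..T} \<Longrightarrow> s \<in> {0<..1} \<Longrightarrow> x \<in> extensional {1..t} \<Longrightarrow>
    q t s x \<in> borel_measurable (block_space {1..t})"
  using measurable_q[of t "\<lambda>_. s" "block_space {1..t}" "\<lambda>_. x" "\<lambda>y. y"]
  by (simp add: space_steps space_block_space)

lemma kernel_bounds:
  assumes t: "t \<in> {1..T}" and s: "s \<in> {0<..1}"
  obtains B where
    "\<And>x y. x \<in> extensional {1..t} \<Longrightarrow> y \<in> extensional {1..t} \<Longrightarrow> 0 < q t s x y"
    "\<And>x y. x \<in> extensional {1..t} \<Longrightarrow> y \<in> extensional {1..t} \<Longrightarrow> q t s x y \<le> B"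
    "\<And>x y i. x \<in> extensional {1..t} \<Longrightarrow> y \<in> extensional {1..t} \<Longrightarrow> i \<in> {1..t} \<Longrightarrow>
       GDERIV (\<lambda>w. q t s x (y(i := w))) (y i) :> q t s x y *\<^sub>R kscore t s x y i"
    "\<And>x y i. x \<in> extensional {1..t} \<Longrightarrow> y \<in> extensional {1..t} \<Longrightarrow> i \<in> {1..t} \<Longrightarrow>
       q t s x y * norm (kscore t s x y i) \<le> B"
    "\<And>x y i. x \<in> extensional {1..t} \<Longrightarrow> y \<in> extensional {1..t} \<Longrightarrow> i \<in> {1..t} \<Longrightarrow>
       q t s x y * (norm (kscore t s x y i))\<^sup>2 \<le> B"
    "\<And>x i. x \<in> extensional {1..t} \<Longrightarrow> i \<in> {1..t} \<Longrightarrow>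
       (\<integral>\<^sup>+y. ennreal (q t s x y * (norm (kscore t s x y i))\<^sup>2) \<partial>block_space {1..t}) \<le> ennreal B"
  using gaussian_transition_score[OF _ q_gaussian[OF t s] measurable_q_last[OF t s] q_prob[OF t s]]
  by blast

lemma q_pos: "t \<in> {1..T} \<Longrightarrow> s \<in> {0<..1} \<Longrightarrow> x \<in> extensional {1..t} \<Longrightarrow> y \<in> extensional {1..t} \<Longrightarrow>
    0 < q t s x y"
  by (erule (1) kernel_bounds)

lemma GDERIV_ln_q:
  assumes t: "t \<in> {1..T}" and s: "s \<in> {0<..1}"
    and x: "x \<in> extensional {1..t}" and y: "y \<in> extensional {1..t}" and i: "i \<in> {1..t}"
  shows "GDERIV (\<lambda>w. ln (q t s x (y(i := w)))) (y i) :> kscore t s x y i"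
proof -
  note pos = q_pos[OF t s x y]
  have "GDERIV (\<lambda>w. q t s x (y(i := w))) (y i) :> q t s x y *\<^sub>R kscore t s x y i"
    using x y i by (rule_tac kernel_bounds[OF t s]) blast
  then have "GDERIV (\<lambda>w. ln (q t s x (y(i := w)))) (y i) :>
      inverse (q t s x y) *\<^sub>R q t s x y *\<^sub>R kscore t s x y i"
    by (rule GDERIV_DERIV_compose) (use pos in \<open>auto intro!: DERIV_ln\<close>)
  then show ?thesis using pos by simp
qed

text \<open>
  The parameters of the Gaussian kernel need not be measurable in \<open>s\<close>, but the score is a limit of
  difference quotients of the jointly measurable \<open>q\<close>.
\<close>

lemma measurable_kscore_triple:
  assumes t: "t \<in> {1..T}" and i: "i \<in> {1..t}"
  shows "(\<lambda>(s, x, y). kscore t s x y i)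
    \<in> borel_measurable (steps \<Otimes>\<^sub>M block_space {1..t} \<Otimes>\<^sub>M block_space {1..t})"
    (is "_ \<in> borel_measurable ?N")
proof (subst borel_measurable_euclidean_space, rule ballI)
  fix b :: 'a assume "b \<in> Basis"
  have [measurable]: "(\<lambda>\<omega>. q t (fst \<omega>) (fst (snd \<omega>)) ((snd (snd \<omega>))(i := (snd (snd \<omega>)) i + c))) \<in> borel_measurable ?N" for c
  proof (rule measurable_q[OF t])
    show "(\<lambda>\<omega>. (snd (snd \<omega>))(i := (snd (snd \<omega>)) i + c)) \<in> measurable ?N (block_space {1..t})"
      by (rule measurable_compose[OF _ measurable_block_translate[OF i]]) measurable
  qed measurable
  \<comment> \<open>The summand \<open>+ 0\<close> puts the second term into the form covered by the
    preceding measurability fact.\<close>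
  let ?D = "\<lambda>n \<omega>. (ln (q t (fst \<omega>) (fst (snd \<omega>)) ((snd (snd \<omega>))(i := (snd (snd \<omega>)) i + inverse (real (Suc n)) *\<^sub>R b)))
      - ln (q t (fst \<omega>) (fst (snd \<omega>)) ((snd (snd \<omega>))(i := (snd (snd \<omega>)) i + 0)))) / inverse (real (Suc n))"
  show "(\<lambda>\<omega>. (case \<omega> of (s, x, y) \<Rightarrow> kscore t s x y i) \<bullet> b) \<in> borel_measurable ?N"
  proof (rule borel_measurable_LIMSEQ_real[where u = ?D])
    fix \<omega> assume "\<omega> \<in> space ?N"
    then obtain s x y where \<omega>: "\<omega> = (s, x, y)" "s \<in> {0<..1}" "x \<in> extensional {1..t}" "y \<in> extensional {1..t}"
      by (auto simp: space_pair_measure space_steps space_block_space)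
    show "(\<lambda>n. ?D n \<omega>) \<longlonglongrightarrow> (case \<omega> of (s, x, y) \<Rightarrow> kscore t s x y i) \<bullet> b"
      using LIMSEQ_GDERIV[OF GDERIV_ln_q[OF t \<omega>(2-4) i], of b]
      by (simp add: \<omega>(1) inner_commute)
  qed measurable
qed

lemma measurable_kscore:
  assumes "t \<in> {1..T}" "i \<in> {1..t}" "S \<in> measurable N steps" "X \<in> measurable N (block_space {1..t})"
    "Y \<in> measurable N (block_space {1..t})"
  shows "(\<lambda>\<omega>. kscore t (S \<omega>) (X \<omega>) (Y \<omega>) i) \<in> borel_measurable N"
  using measurable_compose[OF measurable_Pair[OF assms(3) measurable_Pair[OF assms(4,5)]]
      measurable_kscore_triple[OF assms(1,2)]] by simp

lemma measurable_extend:
  assumes t: "t \<in> {1..T}" and X: "X \<in> measurable N (block_space {1..T})" and V: "V \<in> borel_measurable N"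
  shows "(\<lambda>\<omega>. extend t (X \<omega>) (V \<omega>)) \<in> measurable N (block_space {1..t})"
proof -
  have "(\<lambda>\<omega>. ((X \<omega>)(t := V \<omega>)) i) \<in> measurable N lborel" if "i \<in> {1..t}" for i
    using that t V measurable_compose[OF X measurable_component_singleton, of i]
    by (auto simp: fun_upd_def)
  then show ?thesis by (intro measurable_restrict)
qed

lemma measurable_extend': "(\<lambda>v. extend t x v) \<in> measurable lborel (block_space {1..t})"
  by (intro measurable_restrict) (auto simp: fun_upd_def)

text \<open>The score of the diffused density as a quotient of parameter integrals. It is defined at
  every condition, regular or not, and is jointly measurable in the step, the series and the
  sample.\<close>

definition mix_score_of :: "nat \<Rightarrow> real \<Rightarrow> (nat \<Rightarrow> 'a) \<Rightarrow> (nat \<Rightarrow> 'a) \<Rightarrow> nat \<Rightarrow> 'a" where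
  "mix_score_of t s x y i = (1 / (\<integral>v. next_density T p t x v * q t s (extend t x v) y \<partial>lborel)) *\<^sub>R
     (\<integral>v. next_density T p t x v *\<^sub>R q t s (extend t x v) y *\<^sub>R kscore t s (extend t x v) y i \<partial>lborel)"

text \<open>The exact conditional score in the guise of a network, so that the constant term is
  itself a \<open>loss2\<close>. It carries the series \<open>x\<close> and ignores the condition
  argument \<open>c\<close>.\<close>

definition optimal_net :: "(nat \<Rightarrow> 'a) \<Rightarrow> nat \<Rightarrow> real \<Rightarrow> (nat \<Rightarrow> 'a) \<Rightarrow> (nat \<Rightarrow> 'a) \<Rightarrow> nat \<Rightarrow> 'a" where
  "optimal_net x t s y c = score {1..t} (diffused_density T p q t s x) y"

lemma diffused_density_eq: "diffused_density T p q t s x y =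
    (\<integral>v. next_density T p t x v * q t s (extend t x v) y \<partial>lborel)"
  unfolding diffused_density_def next_density_def by (simp add: mult.commute)

section \<open>Decomposition of the loss at a fixed step and condition\<close>

context
  fixes t :: nat and s :: real and x :: "nat \<Rightarrow> 'a"
  assumes t: "t \<in> {1..T}" and s: "s \<in> {0<..1}" and x: "regular t x"
begin

abbreviation next_law :: "'a measure" where
  "next_law \<equiv> density lborel (\<lambda>v. ennreal (next_density T p t x v))"

text \<open>The constant from \<open>kernel_bounds\<close> is uniform in the clean block, so it
  serves for every appended value \<open>v\<close> at once.\<close>

lemma mixture:
  obtains B where "score_mixture next_law {1..t} (\<lambda>v. q t s (extend t x v)) (\<lambda>v. kscore t s (extend t x v)) B"
proof (rule kernel_bounds[OF t s])
  fix B
  assume b: "\<And>x y. x \<in> extensional {1..t} \<Longrightarrow> y \<in> extensional {1..t} \<Longrightarrow> 0 < q t s x y"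
    "\<And>x y. x \<in> extensional {1..t} \<Longrightarrow> y \<in> extensional {1..t} \<Longrightarrow> q t s x y \<le> B"
    "\<And>x y i. x \<in> extensional {1..t} \<Longrightarrow> y \<in> extensional {1..t} \<Longrightarrow> i \<in> {1..t} \<Longrightarrow>
       GDERIV (\<lambda>w. q t s x (y(i := w))) (y i) :> q t s x y *\<^sub>R kscore t s x y i"
    "\<And>x y i. x \<in> extensional {1..t} \<Longrightarrow> y \<in> extensional {1..t} \<Longrightarrow> i \<in> {1..t} \<Longrightarrow>
       q t s x y * norm (kscore t s x y i) \<le> B"
    "\<And>x y i. x \<in> extensional {1..t} \<Longrightarrow> y \<in> extensional {1..t} \<Longrightarrow> i \<in> {1..t} \<Longrightarrow>
       q t s x y * (norm (kscore t s x y i))\<^sup>2 \<le> B"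
    "\<And>x i. x \<in> extensional {1..t} \<Longrightarrow> i \<in> {1..t} \<Longrightarrow>
       (\<integral>\<^sup>+y. ennreal (q t s x y * (norm (kscore t s x y i))\<^sup>2) \<partial>block_space {1..t}) \<le> ennreal B"
  have sets: "sets (next_law \<Otimes>\<^sub>M block_space {1..t}) = sets (lborel \<Otimes>\<^sub>M block_space {1..t})"
    by (intro sets_pair_measure_cong) auto
  have maps: "(\<lambda>\<omega>. s) \<in> measurable (lborel \<Otimes>\<^sub>M block_space {1..t}) steps"
    "(\<lambda>\<omega>. extend t x (fst \<omega>)) \<in> measurable (lborel \<Otimes>\<^sub>M block_space {1..t}) (block_space {1..t})"
    "snd \<in> measurable (lborel \<Otimes>\<^sub>M block_space {1..t}) (block_space {1..t})"
    using s measurable_compose[OF measurable_fst measurable_extend'] by (simp_all only: measurable_snd measurable_const space_steps)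
  have "score_mixture next_law {1..t} (\<lambda>v. q t s (extend t x v)) (\<lambda>v. kscore t s (extend t x v)) B"
  proof (intro score_mixture.intro prob_space_next[OF t x] score_mixture_axioms.intro)
    show "(\<lambda>(v, y). q t s (extend t x v) y) \<in> borel_measurable (next_law \<Otimes>\<^sub>M block_space {1..t})"
      unfolding measurable_cong_sets[OF sets refl] split_beta' by (rule measurable_q[OF t maps])
    show "(\<lambda>(v, y). kscore t s (extend t x v) y i) \<in> borel_measurable (next_law \<Otimes>\<^sub>M block_space {1..t})"
      if "i \<in> {1..t}" for i
      unfolding measurable_cong_sets[OF sets refl] split_beta' by (rule measurable_kscore[OF t that maps])
  qed (use b in auto)
  then show ?thesis by (rule that)
qed

lemma next_integral:
  fixes h :: "'a \<Rightarrow> 'b::{banach, second_countable_topology}"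
  assumes "h \<in> borel_measurable lborel"
  shows "(\<integral>v. h v \<partial>next_law) = (\<integral>v. next_density T p t x v *\<^sub>R h v \<partial>lborel)"
  using assms measurable_next_density'[OF t] by (intro integral_density) (auto simp: next_density_nonneg)

lemma
  assumes y: "y \<in> extensional {1..t}"
  shows measurable_q_mid: "(\<lambda>v. q t s (extend t x v) y) \<in> borel_measurable lborel"
    and measurable_kscore_mid: "i \<in> {1..t} \<Longrightarrow> (\<lambda>v. kscore t s (extend t x v) y i) \<in> borel_measurable lborel"
proof -
  have maps: "(\<lambda>_. s) \<in> measurable lborel steps" "(\<lambda>_. y) \<in> measurable lborel (block_space {1..t})"
    using s y by (simp_all only: measurable_const space_steps space_block_space)
  show "(\<lambda>v. q t s (extend t x v) y) \<in> borel_measurable lborel"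
    by (rule measurable_q[OF t maps(1) measurable_extend' maps(2)])
  show "(\<lambda>v. kscore t s (extend t x v) y i) \<in> borel_measurable lborel" if "i \<in> {1..t}"
    by (rule measurable_kscore[OF t that maps(1) measurable_extend' maps(2)])
qed

lemma
  shows score_diffused: "y \<in> extensional {1..t} \<Longrightarrow> i \<in> {1..t} \<Longrightarrow>
      score {1..t} (diffused_density T p q t s x) y i = mix_score_of t s x y i"
    and loss2_optimal_finite: "loss2 T p q (optimal_net x) t s x < \<infinity>"
    and loss_decomposition:
      "(\<And>i. i \<in> {1..t} \<Longrightarrow> (\<lambda>y. M t s y (condition t x) i) \<in> borel_measurable (block_space {1..t})) \<Longrightarrow>
       loss2 T p q M t s x = loss1 T p q M t s x + loss2 T p q (optimal_net x) t s x"
proof -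
  obtain B where "score_mixture next_law {1..t} (\<lambda>v. q t s (extend t x v)) (\<lambda>v. kscore t s (extend t x v)) B"
    by (rule mixture)
  then interpret mx: score_mixture next_law "{1..t}" "\<lambda>v. q t s (extend t x v)" "\<lambda>v. kscore t s (extend t x v)" B .
  \<comment> \<open>The two densities are identified on extensional blocks only, which suffices for
    both the score and the integrals.\<close>
  have mix: "mx.mix y = diffused_density T p q t s x y" if "y \<in> extensional {1..t}" for y
    unfolding mx.mix_def diffused_density_eq using next_integral[OF measurable_q_mid[OF that]] by simp
  have sc: "score {1..t} mx.mix y = score {1..t} (diffused_density T p q t s x) y"
    if "y \<in> extensional {1..t}" for y
    using that mix by (rule score_cong)
  show "score {1..t} (diffused_density T p q t s x) y i = mix_score_of t s x y i"
    if y: "y \<in> extensional {1..t}" and i: "i \<in> {1..t}" for y i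
  proof -
    have "(\<integral>v. q t s (extend t x v) y *\<^sub>R kscore t s (extend t x v) y i \<partial>next_law) =
        (\<integral>v. next_density T p t x v *\<^sub>R q t s (extend t x v) y *\<^sub>R kscore t s (extend t x v) y i \<partial>lborel)"
      using measurable_q_mid[OF y] measurable_kscore_mid[OF y i] by (intro next_integral) simp
    then show ?thesis
      using mx.score_mix[OF y i]
      unfolding sc[OF y] mx.mix_score_def mix[OF y] mix_score_of_def diffused_density_eq by simp
  qed
  have l2: "loss2 T p q M t s x = mx.kernel_loss (\<lambda>y. M t s y (condition t x))" for M
    unfolding loss2_def mx.kernel_loss_def Let_def by (rule refl)
  have opt: "loss2 T p q (optimal_net x) t s x = mx.kernel_loss (score {1..t} mx.mix)"
    unfolding l2 mx.kernel_loss_def optimal_net_def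
    by (intro nn_integral_cong) (simp only: space_density space_block_space sc)
  show "loss2 T p q (optimal_net x) t s x < \<infinity>"
    unfolding opt by (rule mx.kernel_loss_score_finite)
  show "loss2 T p q M t s x = loss1 T p q M t s x + loss2 T p q (optimal_net x) t s x"
    if M: "\<And>i. i \<in> {1..t} \<Longrightarrow> (\<lambda>y. M t s y (condition t x) i) \<in> borel_measurable (block_space {1..t})"
  proof -
    have mm: "(\<lambda>y. ennreal (mx.mix y)) \<in> borel_measurable (block_space {1..t})"
      by measurable
    have eq: "ennreal (diffused_density T p q t s x y) = ennreal (mx.mix y)"
      if "y \<in> space (block_space {1..t})" for y
      using that mix by (simp only: space_block_space)
    have "density (block_space {1..t}) (\<lambda>y. ennreal (diffused_density T p q t s x y)) =
        density (block_space {1..t}) (\<lambda>y. ennreal (mx.mix y))"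
      using mm by (intro density_cong AE_I2 eq) (simp_all only: measurable_cong[OF eq])
    then have "loss1 T p q M t s x = (\<integral>\<^sup>+y. ennreal (block_sqnorm {1..t}
        (\<lambda>i. M t s y (condition t x) i - score {1..t} (diffused_density T p q t s x) y i))
        \<partial>density (block_space {1..t}) (\<lambda>y. ennreal (mx.mix y)))"
      unfolding loss1_def by (rule arg_cong)
    also have "\<dots> = (\<integral>\<^sup>+y. ennreal (block_sqnorm {1..t}
        (\<lambda>i. M t s y (condition t x) i - score {1..t} mx.mix y i))
        \<partial>density (block_space {1..t}) (\<lambda>y. ennreal (mx.mix y)))"
      by (intro nn_integral_cong) (simp only: sc space_density space_block_space)
    finally have "loss1 T p q M t s x = \<dots>" .
    then show ?thesis
      unfolding opt l2[of M] using mx.kernel_loss_decomposition[OF M] by simp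
  qed
qed

end

text \<open>The densities become factors over fixed Lebesgue measures, so that measurability of
  parameter integrals applies; in \<open>loss2\<close> the measures themselves vary with the
  parameters. The network \<open>m\<close> may depend on the whole series, which lets
  \<open>mix_score_of\<close> take its place.\<close>

definition loss2_version ::
    "nat \<Rightarrow> (real \<Rightarrow> (nat \<Rightarrow> 'a) \<Rightarrow> (nat \<Rightarrow> 'a) \<Rightarrow> nat \<Rightarrow> 'a) \<Rightarrow> real \<Rightarrow> (nat \<Rightarrow> 'a) \<Rightarrow> ennreal" where
  "loss2_version t m s x = (\<integral>\<^sup>+v. ennreal (next_density T p t x v) *
     (\<integral>\<^sup>+y. ennreal (q t s (extend t x v) y) *
        ennreal (block_sqnorm {1..t} (\<lambda>i. m s x y i - kscore t s (extend t x v) y i))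
      \<partial>block_space {1..t}) \<partial>lborel)"

lemma measurable_loss2_version:
  assumes t: "t \<in> {1..T}"
    and m: "\<And>i. i \<in> {1..t} \<Longrightarrow> (\<lambda>(s, x, y). m s x y i)
      \<in> borel_measurable (steps \<Otimes>\<^sub>M block_space {1..T} \<Otimes>\<^sub>M block_space {1..t})"
  shows "(\<lambda>(s, x). loss2_version t m s x) \<in> borel_measurable (steps \<Otimes>\<^sub>M block_space {1..T})"
proof -
  interpret sigma_finite_measure "block_space {1..t} :: (nat \<Rightarrow> 'a) measure"
    by (rule sigma_finite_block_space) simp
  let ?N = "steps \<Otimes>\<^sub>M (block_space {1..T} :: (nat \<Rightarrow> 'a) measure)"
  let ?N2 = "(?N \<Otimes>\<^sub>M (lborel :: 'a measure)) \<Otimes>\<^sub>M (block_space {1..t} :: (nat \<Rightarrow> 'a) measure)"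
  have S: "(\<lambda>\<omega>. fst (fst (fst \<omega>))) \<in> measurable ?N2 steps"
    and X: "(\<lambda>\<omega>. snd (fst (fst \<omega>))) \<in> measurable ?N2 (block_space {1..T})"
    and V: "(\<lambda>\<omega>. snd (fst \<omega>)) \<in> borel_measurable ?N2"
    and Y: "snd \<in> measurable ?N2 (block_space {1..t})"
    by measurable
  note E = measurable_extend[OF t X V]
  note [measurable] = measurable_q[OF t S E Y] measurable_kscore[OF t _ S E Y]
  have [measurable]: "(\<lambda>\<omega>. m (fst (fst (fst \<omega>))) (snd (fst (fst \<omega>))) (snd \<omega>) i) \<in> borel_measurable ?N2"
    if "i \<in> {1..t}" for i
    using measurable_compose[OF measurable_Pair[OF S measurable_Pair[OF X Y]] m[OF that]] by simp
  have "(\<lambda>\<omega>. ennreal (q t (fst (fst (fst \<omega>))) (extend t (snd (fst (fst \<omega>))) (snd (fst \<omega>))) (snd \<omega>)) *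
        ennreal (block_sqnorm {1..t} (\<lambda>i. m (fst (fst (fst \<omega>))) (snd (fst (fst \<omega>))) (snd \<omega>) i
          - kscore t (fst (fst (fst \<omega>))) (extend t (snd (fst (fst \<omega>))) (snd (fst \<omega>))) (snd \<omega>) i)))
      \<in> borel_measurable ?N2"
    unfolding block_sqnorm_def by measurable
  then have inner: "(\<lambda>\<omega>. \<integral>\<^sup>+y. ennreal (q t (fst (fst \<omega>)) (extend t (snd (fst \<omega>)) (snd \<omega>)) y) *
        ennreal (block_sqnorm {1..t} (\<lambda>i. m (fst (fst \<omega>)) (snd (fst \<omega>)) y i
          - kscore t (fst (fst \<omega>)) (extend t (snd (fst \<omega>)) (snd \<omega>)) y i)) \<partial>block_space {1..t})
      \<in> borel_measurable (?N \<Otimes>\<^sub>M lborel)"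
    by (intro borel_measurable_nn_integral) (simp add: split_beta')
  have "(\<lambda>\<omega>. next_density T p t (snd (fst \<omega>)) (snd \<omega>)) \<in> borel_measurable (?N \<Otimes>\<^sub>M lborel)"
    using measurable_compose[OF _ measurable_next_density[OF t], of "\<lambda>\<omega>. (snd (fst \<omega>), snd \<omega>)" "?N \<Otimes>\<^sub>M lborel"]
    by simp
  with inner have "(\<lambda>\<omega>. ennreal (next_density T p t (snd (fst \<omega>)) (snd \<omega>)) *
      (\<integral>\<^sup>+y. ennreal (q t (fst (fst \<omega>)) (extend t (snd (fst \<omega>)) (snd \<omega>)) y) *
        ennreal (block_sqnorm {1..t} (\<lambda>i. m (fst (fst \<omega>)) (snd (fst \<omega>)) y i
          - kscore t (fst (fst \<omega>)) (extend t (snd (fst \<omega>)) (snd \<omega>)) y i)) \<partial>block_space {1..t}))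
      \<in> borel_measurable (?N \<Otimes>\<^sub>M lborel)"
    by measurable
  then show ?thesis
    unfolding loss2_version_def split_beta'
    by (intro lborel.borel_measurable_nn_integral) (simp add: split_beta')
qed

lemma loss2_eq_version:
  assumes t: "t \<in> {1..T}" and s: "s \<in> {0<..1}" and x: "x \<in> space (block_space {1..T})"
    and m: "\<And>i. i \<in> {1..t} \<Longrightarrow> (\<lambda>(s, x, y). m s x y i)
      \<in> borel_measurable (steps \<Otimes>\<^sub>M block_space {1..T} \<Otimes>\<^sub>M block_space {1..t})"
    and M: "\<And>y i. y \<in> extensional {1..t} \<Longrightarrow> i \<in> {1..t} \<Longrightarrow> M t s y (condition t x) i = m s x y i"
  shows "loss2 T p q M t s x = loss2_version t m s x"
proof -
  interpret sigma_finite_measure "block_space {1..t} :: (nat \<Rightarrow> 'a) measure"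
    by (rule sigma_finite_block_space) simp
  let ?N = "lborel \<Otimes>\<^sub>M (block_space {1..t} :: (nat \<Rightarrow> 'a) measure)"
  have S: "(\<lambda>_. s) \<in> measurable ?N steps" and X: "(\<lambda>_. x) \<in> measurable ?N (block_space {1..T})"
    and V: "fst \<in> borel_measurable ?N" and Y: "snd \<in> measurable ?N (block_space {1..t})"
    using s x by (auto simp: space_steps)
  note E = measurable_extend[OF t X V]
  note [measurable] = measurable_q[OF t S E Y] measurable_kscore[OF t _ S E Y]
  have [measurable]: "(\<lambda>\<omega>. m s x (snd \<omega>) i) \<in> borel_measurable ?N"
    if "i \<in> {1..t}" for i
    using measurable_compose[OF measurable_Pair[OF S measurable_Pair[OF X Y]] m[OF that]] by simp
  let ?G = "\<lambda>v y. ennreal (block_sqnorm {1..t} (\<lambda>i. m s x y i - kscore t s (extend t x v) y i))"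
  have G: "(\<lambda>\<omega>. ?G (fst \<omega>) (snd \<omega>)) \<in> borel_measurable ?N"
    unfolding block_sqnorm_def by measurable
  have qm: "(\<lambda>\<omega>. q t s (extend t x (fst \<omega>)) (snd \<omega>)) \<in> borel_measurable ?N" by measurable
  have inner: "(\<integral>\<^sup>+y. ennreal (block_sqnorm {1..t} (\<lambda>i. M t s y (condition t x) i - kscore t s (extend t x v) y i))
      \<partial>density (block_space {1..t}) (\<lambda>y. ennreal (q t s (extend t x v) y))) =
      (\<integral>\<^sup>+y. ennreal (q t s (extend t x v) y) * ?G v y \<partial>block_space {1..t})" for v
  proof -
    have "block_sqnorm {1..t} (\<lambda>i. M t s y (condition t x) i - kscore t s (extend t x v) y i)
        = block_sqnorm {1..t} (\<lambda>i. m s x y i - kscore t s (extend t x v) y i)"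
      if "y \<in> extensional {1..t}" for y
      using M[OF that] unfolding block_sqnorm_def by (intro sum.cong) auto
    then have "(\<integral>\<^sup>+y. ennreal (block_sqnorm {1..t} (\<lambda>i. M t s y (condition t x) i - kscore t s (extend t x v) y i))
      \<partial>density (block_space {1..t}) (\<lambda>y. ennreal (q t s (extend t x v) y))) =
      (\<integral>\<^sup>+y. ?G v y \<partial>density (block_space {1..t}) (\<lambda>y. ennreal (q t s (extend t x v) y)))"
      by (intro nn_integral_cong) (simp add: space_block_space)
    also have "\<dots> = (\<integral>\<^sup>+y. ennreal (q t s (extend t x v) y) * ?G v y \<partial>block_space {1..t})"
      using measurable_compose[OF measurable_Pair1' qm, of v] measurable_compose[OF measurable_Pair1' G, of v]
      by (intro nn_integral_density) auto
    finally show ?thesis .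
  qed
  have "(\<lambda>\<omega>. ennreal (q t s (extend t x (fst \<omega>)) (snd \<omega>)) * ?G (fst \<omega>) (snd \<omega>)) \<in> borel_measurable ?N"
    using G qm by measurable
  then have "(\<lambda>v. \<integral>\<^sup>+y. ennreal (q t s (extend t x v) y) * ?G v y \<partial>block_space {1..t}) \<in> borel_measurable lborel"
    by (intro borel_measurable_nn_integral) (simp add: split_beta')
  then show ?thesis
    unfolding loss2_def loss2_version_def Let_def inner
    using measurable_next_density'[OF t, of x] by (intro nn_integral_density) auto
qed

lemma measurable_mix_score_of:
  assumes t: "t \<in> {1..T}" and i: "i \<in> {1..t}"
  shows "(\<lambda>(s, x, y). mix_score_of t s x y i)
    \<in> borel_measurable (steps \<Otimes>\<^sub>M block_space {1..T} \<Otimes>\<^sub>M block_space {1..t})"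
proof -
  let ?N = "steps \<Otimes>\<^sub>M (block_space {1..T} :: (nat \<Rightarrow> 'a) measure) \<Otimes>\<^sub>M (block_space {1..t} :: (nat \<Rightarrow> 'a) measure)"
  let ?N2 = "?N \<Otimes>\<^sub>M (lborel :: 'a measure)"
  have S: "(\<lambda>\<omega>. fst (fst \<omega>)) \<in> measurable ?N2 steps"
    and X: "(\<lambda>\<omega>. fst (snd (fst \<omega>))) \<in> measurable ?N2 (block_space {1..T})"
    and V: "snd \<in> borel_measurable ?N2"
    and Y: "(\<lambda>\<omega>. snd (snd (fst \<omega>))) \<in> measurable ?N2 (block_space {1..t})"
    by measurable
  note E = measurable_extend[OF t X V]
  note [measurable] = measurable_q[OF t S E Y] measurable_kscore[OF t i S E Y]
  have [measurable]: "(\<lambda>\<omega>. next_density T p t (fst (snd (fst \<omega>))) (snd \<omega>)) \<in> borel_measurable ?N2"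
    using measurable_compose[OF _ measurable_next_density[OF t], of "\<lambda>\<omega>. (fst (snd (fst \<omega>)), snd \<omega>)" ?N2]
    by simp
  have "(\<lambda>\<omega>. next_density T p t (fst (snd (fst \<omega>))) (snd \<omega>) *
      q t (fst (fst \<omega>)) (extend t (fst (snd (fst \<omega>))) (snd \<omega>)) (snd (snd (fst \<omega>)))) \<in> borel_measurable ?N2"
    by measurable
  moreover have "(\<lambda>\<omega>. next_density T p t (fst (snd (fst \<omega>))) (snd \<omega>) *\<^sub>R
      q t (fst (fst \<omega>)) (extend t (fst (snd (fst \<omega>))) (snd \<omega>)) (snd (snd (fst \<omega>))) *\<^sub>R
      kscore t (fst (fst \<omega>)) (extend t (fst (snd (fst \<omega>))) (snd \<omega>)) (snd (snd (fst \<omega>))) i) \<in> borel_measurable ?N2"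
    by measurable
  ultimately show ?thesis
    unfolding mix_score_of_def split_beta'
    by (intro borel_measurable_scaleR borel_measurable_divide borel_measurable_const
        lborel.borel_measurable_lebesgue_integral) (simp_all add: split_beta')
qed

end

section \<open>Objectives\<close>

text \<open>Preimages under \<open>f\<close> and \<open>g\<close> differ by a null set, and the
  completion contains such modifications. It is needed because the losses are controlled only at
  regular conditions.\<close>

lemma borel_measurable_completion_AE:
  fixes f g :: "'x \<Rightarrow> 'b::topological_space"
  assumes g: "g \<in> borel_measurable M" and eq: "AE x in M. f x = g x"
  shows "f \<in> borel_measurable (completion M)"
proof (rule measurableI)
  fix A :: "'b set" assume "A \<in> sets borel"
  then have A: "g -` A \<inter> space M \<in> sets (completion M)"
    using g by (auto dest: measurable_sets)
  have "AE x in completion M. x \<in> g -` A \<inter> space M \<longleftrightarrow> x \<in> f -` A \<inter> space M"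
    by (rule AE_completion) (use eq in eventually_elim, auto)
  then show "f -` A \<inter> space (completion M) \<in> sets (completion M)"
    using completion.in_sets_AE[OF _ A] by auto
qed simp

abbreviation step_law :: "real measure" where
  "step_law \<equiv> restrict_space lborel {0<..1}"

text \<open>Nothing is asked of \<open>F\<close> at 0, since a single point is null.\<close>

lemma nn_integral_step_law:
  assumes "\<And>s. s \<in> {0<..1} \<Longrightarrow> F s = G s"
  shows "(\<integral>\<^sup>+s\<in>{0..1}. F s \<partial>lborel) = (\<integral>\<^sup>+s. G s \<partial>step_law)"
proof -
  have "(\<integral>\<^sup>+s. G s \<partial>step_law) = (\<integral>\<^sup>+s. G s * indicator {0<..1} s \<partial>lborel)"
    by (rule nn_integral_restrict_space) simp
  also have "\<dots> = (\<integral>\<^sup>+s\<in>{0..1}. F s \<partial>lborel)"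
    by (rule nn_integral_cong_AE, use AE_lborel_singleton[of "0::real"] in eventually_elim)
      (auto simp: assms split: split_indicator)
  finally show ?thesis ..
qed

lemma set_integral_step_law:
  fixes F G :: "real \<Rightarrow> real"
  assumes "\<And>s. s \<in> {0<..1} \<Longrightarrow> F s = G s"
  shows "(LINT s:{0..1}|lborel. F s) = (\<integral>s. G s \<partial>step_law)"
proof -
  have "(\<integral>s. G s \<partial>step_law) = (\<integral>s. indicator {0<..1} s *\<^sub>R G s \<partial>lborel)"
    by (rule integral_restrict_space) simp
  also have "\<dots> = (LINT s:{0..1}|lborel. F s)"
    unfolding set_lebesgue_integral_def
    by (rule integral_discrete_difference[where X = "{0}"]) (auto simp: assms split: split_indicator)
  finally show ?thesis ..
qed

lemma objective_converges_mono:
  assumes le: "AE x in series_law T p. \<forall>t\<in>{1..T}. \<forall>s\<in>{0<..1}. l t s x \<le> l' t s x"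
    and conv: "objective_converges T p lam l'"
  shows "objective_converges T p lam l"
proof -
  have "(\<integral>\<^sup>+x. (\<Sum>t\<in>{1..T}. ennreal \<bar>lam s\<bar> * l t s x) \<partial>series_law T p) \<le>
      (\<integral>\<^sup>+x. (\<Sum>t\<in>{1..T}. ennreal \<bar>lam s\<bar> * l' t s x) \<partial>series_law T p)" if "s \<in> {0<..1}" for s
    by (rule nn_integral_mono_AE, use le in eventually_elim)
      (use that in \<open>auto intro!: sum_mono mult_left_mono\<close>)
  then have "(\<integral>\<^sup>+s. (\<integral>\<^sup>+x. (\<Sum>t\<in>{1..T}. ennreal \<bar>lam s\<bar> * l t s x) \<partial>series_law T p) \<partial>step_law)
      \<le> (\<integral>\<^sup>+s. (\<integral>\<^sup>+x. (\<Sum>t\<in>{1..T}. ennreal \<bar>lam s\<bar> * l' t s x) \<partial>series_law T p) \<partial>step_law)"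
    by (rule nn_integral_mono) (simp only: space_restrict_space Int_iff)
  then show ?thesis
    using conv unfolding objective_converges_def nn_integral_step_law[OF refl]
    by (rule le_less_trans)
qed

section \<open>Objectives as integrals over the product of step and series\<close>

context series_density
begin

lemma series_law_eq: "series_law T p = completion law"
  by (simp add: series_law_def)

lemma pair_sigma_finite_step_law: "pair_sigma_finite step_law law"
proof -
  interpret S: finite_measure step_law
    by (rule finite_measureI) (simp add: space_restrict_space emeasure_restrict_space)
  interpret P: prob_space law by (rule p_prob)
  show ?thesis ..
qed

text \<open>\<open>l\<close> is a loss as defined and \<open>l'\<close> a jointly measurable version
  of it. The exceptional set of series is common to all \<open>t\<close> and \<open>s\<close>, so
  the inner expectation can be switched to \<open>l'\<close> at every single step.\<close>

context
  fixes lam :: "real \<Rightarrow> real" and l l' :: "nat \<Rightarrow> real \<Rightarrow> (nat \<Rightarrow> 'a) \<Rightarrow> ennreal"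
  assumes lam: "lam \<in> borel_measurable steps"
    and l': "\<And>t. t \<in> {1..T} \<Longrightarrow> (\<lambda>(s, x). l' t s x) \<in> borel_measurable (steps \<Otimes>\<^sub>M block_space {1..T})"
    and eq: "AE x in law. \<forall>t\<in>{1..T}. \<forall>s\<in>{0<..1}. l t s x = l' t s x"
begin

lemma sets_steps_law: "sets (step_law \<Otimes>\<^sub>M law) = sets (steps \<Otimes>\<^sub>M block_space {1..T})"
  by (intro sets_pair_measure_cong sets_restrict_space_cong) auto

lemma measurable_lam: "(\<lambda>\<omega>. lam (fst \<omega>)) \<in> borel_measurable (step_law \<Otimes>\<^sub>M law)"
  unfolding measurable_cong_sets[OF sets_steps_law refl]
  by (rule measurable_compose[OF measurable_fst lam])

lemma measurable_l': "t \<in> {1..T} \<Longrightarrow> (\<lambda>\<omega>. l' t (fst \<omega>) (snd \<omega>)) \<in> borel_measurable (step_law \<Otimes>\<^sub>M law)"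
  unfolding measurable_cong_sets[OF sets_steps_law refl] using l' by (simp add: split_beta')

lemma objective_converges_iff:
  "objective_converges T p lam l \<longleftrightarrow>
    (\<integral>\<^sup>+\<omega>. (\<Sum>t\<in>{1..T}. ennreal \<bar>lam (fst \<omega>)\<bar> * l' t (fst \<omega>) (snd \<omega>)) \<partial>(step_law \<Otimes>\<^sub>M law)) < \<infinity>"
proof -
  interpret pair_sigma_finite step_law law by (rule pair_sigma_finite_step_law)
  note [measurable] = measurable_lam measurable_l'
  have "(\<integral>\<^sup>+x. (\<Sum>t\<in>{1..T}. ennreal \<bar>lam s\<bar> * l t s x) \<partial>series_law T p) =
      (\<integral>\<^sup>+x. (\<Sum>t\<in>{1..T}. ennreal \<bar>lam s\<bar> * l' t s x) \<partial>law)" if "s \<in> {0<..1}" for s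
    unfolding series_law_eq nn_integral_completion
    by (rule nn_integral_cong_AE, use eq in eventually_elim) (use that in auto)
  then have "(\<integral>\<^sup>+s\<in>{0..1}. (\<integral>\<^sup>+x. (\<Sum>t\<in>{1..T}. ennreal \<bar>lam s\<bar> * l t s x) \<partial>series_law T p) \<partial>lborel)
      = (\<integral>\<^sup>+s. \<integral>\<^sup>+x. (\<Sum>t\<in>{1..T}. ennreal \<bar>lam s\<bar> * l' t s x) \<partial>law \<partial>step_law)"
    by (rule nn_integral_step_law)
  also have "\<dots> = (\<integral>\<^sup>+\<omega>. (\<Sum>t\<in>{1..T}. ennreal \<bar>lam (fst \<omega>)\<bar> * l' t (fst \<omega>) (snd \<omega>)) \<partial>(step_law \<Otimes>\<^sub>M law))"
    by (subst M2.nn_integral_fst[symmetric]) (simp_all only: fst_conv snd_conv, measurable)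
  finally show ?thesis by (simp only: objective_converges_def)
qed

text \<open>The iterated expectation becomes one integral over step and series, where linearity is
  available. Convergence dominates the integrand, because \<open>enn2real\<close> never increases a
  value and sends infinity to 0.\<close>

lemma
  assumes conv: "objective_converges T p lam l"
  shows objective_integrable: "integrable (step_law \<Otimes>\<^sub>M law)
      (\<lambda>\<omega>. \<Sum>t\<in>{1..T}. lam (fst \<omega>) * enn2real (l' t (fst \<omega>) (snd \<omega>)))"
    and objective_eq_integral: "objective T p lam l =
      (\<integral>\<omega>. (\<Sum>t\<in>{1..T}. lam (fst \<omega>) * enn2real (l' t (fst \<omega>) (snd \<omega>))) \<partial>(step_law \<Otimes>\<^sub>M law))"
proof -
  interpret pair_sigma_finite step_law law by (rule pair_sigma_finite_step_law)
  note [measurable] = measurable_lam measurable_l'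
  let ?h = "\<lambda>\<omega>. \<Sum>t\<in>{1..T}. lam (fst \<omega>) * enn2real (l' t (fst \<omega>) (snd \<omega>))"
  have bound: "ennreal (norm (?h \<omega>)) \<le> (\<Sum>t\<in>{1..T}. ennreal \<bar>lam (fst \<omega>)\<bar> * l' t (fst \<omega>) (snd \<omega>))" for \<omega>
  proof -
    have "norm (?h \<omega>) \<le> (\<Sum>t\<in>{1..T}. \<bar>lam (fst \<omega>)\<bar> * enn2real (l' t (fst \<omega>) (snd \<omega>)))"
      by (rule order_trans[OF norm_sum]) (simp add: abs_mult)
    then have "ennreal (norm (?h \<omega>)) \<le> ennreal \<dots>" by (rule ennreal_leI)
    also have "\<dots> = (\<Sum>t\<in>{1..T}. ennreal \<bar>lam (fst \<omega>)\<bar> * ennreal (enn2real (l' t (fst \<omega>) (snd \<omega>))))"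
      by (subst sum_ennreal[symmetric]) (auto simp: ennreal_mult)
    also have "\<dots> \<le> (\<Sum>t\<in>{1..T}. ennreal \<bar>lam (fst \<omega>)\<bar> * l' t (fst \<omega>) (snd \<omega>))"
      by (intro sum_mono mult_left_mono) (auto simp: ennreal_enn2real_if)
    finally show ?thesis .
  qed
  have hm: "?h \<in> borel_measurable (step_law \<Otimes>\<^sub>M law)" by measurable
  show int: "integrable (step_law \<Otimes>\<^sub>M law) ?h"
  proof (rule integrableI_bounded[OF hm])
    have "(\<integral>\<^sup>+\<omega>. ennreal (norm (?h \<omega>)) \<partial>(step_law \<Otimes>\<^sub>M law)) \<le>
        (\<integral>\<^sup>+\<omega>. (\<Sum>t\<in>{1..T}. ennreal \<bar>lam (fst \<omega>)\<bar> * l' t (fst \<omega>) (snd \<omega>)) \<partial>(step_law \<Otimes>\<^sub>M law))"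
      by (rule nn_integral_mono[OF bound])
    also have "\<dots> < \<infinity>"
      using conv unfolding objective_converges_iff .
    finally show "(\<integral>\<^sup>+\<omega>. ennreal (norm (?h \<omega>)) \<partial>(step_law \<Otimes>\<^sub>M law)) < \<infinity>" .
  qed
  have "(\<integral>x. (\<Sum>t\<in>{1..T}. lam s * enn2real (l t s x)) \<partial>series_law T p) = (\<integral>x. ?h (s, x) \<partial>law)"
    if s: "s \<in> {0<..1}" for s
  proof -
    have m: "(\<lambda>x. ?h (s, x)) \<in> borel_measurable law"
      using measurable_compose[OF measurable_Pair1' hm, of s] s by (simp add: space_restrict_space)
    have ae: "AE x in law. (\<Sum>t\<in>{1..T}. lam s * enn2real (l t s x)) = ?h (s, x)"
      using eq by eventually_elim (use s in auto)
    have "(\<integral>x. (\<Sum>t\<in>{1..T}. lam s * enn2real (l t s x)) \<partial>completion law) = (\<integral>x. ?h (s, x) \<partial>completion law)"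
      by (rule integral_cong_AE[OF borel_measurable_completion_AE[OF m ae] measurable_completion[OF m]
            AE_completion[OF ae]])
    then show ?thesis
      unfolding series_law_eq integral_completion[OF m] .
  qed
  then have "objective T p lam l = (\<integral>s. \<integral>x. ?h (s, x) \<partial>law \<partial>step_law)"
    unfolding objective_def by (rule set_integral_step_law)
  also have "\<dots> = (\<integral>\<omega>. ?h \<omega> \<partial>(step_law \<Otimes>\<^sub>M law))"
    by (rule integral_fst'[OF int])
  finally show "objective T p lam l = (\<integral>\<omega>. ?h \<omega> \<partial>(step_law \<Otimes>\<^sub>M law))" .
qed

end

text \<open>Only \<open>l2\<close> and \<open>l3\<close> come with measurable versions. For
  \<open>l1\<close> one is obtained as a difference, which is legitimate since \<open>l3\<close> is
  finite. Both \<open>l1\<close> and \<open>l3\<close> lie below \<open>l2\<close>, so their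
  objectives inherit convergence.\<close>

lemma objective_add:
  fixes l1 l2 l3 l2' l3' :: "nat \<Rightarrow> real \<Rightarrow> (nat \<Rightarrow> 'a) \<Rightarrow> ennreal"
  assumes lam: "lam \<in> borel_measurable steps"
    and l2': "\<And>t. t \<in> {1..T} \<Longrightarrow> (\<lambda>(s, x). l2' t s x) \<in> borel_measurable (steps \<Otimes>\<^sub>M block_space {1..T})"
    and l3': "\<And>t. t \<in> {1..T} \<Longrightarrow> (\<lambda>(s, x). l3' t s x) \<in> borel_measurable (steps \<Otimes>\<^sub>M block_space {1..T})"
    and ae: "AE x in law. \<forall>t\<in>{1..T}. \<forall>s\<in>{0<..1}. l2 t s x = l2' t s x \<and> l3 t s x = l3' t s x \<and>
      l2 t s x = l1 t s x + l3 t s x \<and> l3 t s x < \<infinity>"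
    and conv: "objective_converges T p lam l2"
  shows "objective_converges T p lam l1 \<and>
    objective T p lam l2 = objective T p lam l1 + objective T p lam l3"
proof -
  interpret pair_sigma_finite step_law law by (rule pair_sigma_finite_step_law)
  define l1' where "l1' t s x = l2' t s x - l3' t s x" for t s x
  have l1': "(\<lambda>(s, x). l1' t s x) \<in> borel_measurable (steps \<Otimes>\<^sub>M block_space {1..T})" if "t \<in> {1..T}" for t
    unfolding l1'_def split_beta' using l2'[OF that] l3'[OF that]
    by (intro borel_measurable_minus_ennreal) (simp_all add: split_beta')
  have eq1: "AE x in law. \<forall>t\<in>{1..T}. \<forall>s\<in>{0<..1}. l1 t s x = l1' t s x"
    using ae
  proof (eventually_elim, intro ballI)
    fix x t s
    assume "\<forall>t\<in>{1..T}. \<forall>s\<in>{0<..1}. l2 t s x = l2' t s x \<and> l3 t s x = l3' t s x \<and>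
      l2 t s x = l1 t s x + l3 t s x \<and> l3 t s x < \<infinity>" "t \<in> {1..T}" "s \<in> {0<..1::real}"
    then have "l2 t s x = l2' t s x" "l3 t s x = l3' t s x" "l2 t s x = l1 t s x + l3 t s x"
      "l3 t s x < \<infinity>" by blast+
    then show "l1 t s x = l1' t s x"
      unfolding l1'_def by (metis ennreal_add_diff_cancel_right infinity_ennreal_def less_irrefl)
  qed
  have eq2: "AE x in law. \<forall>t\<in>{1..T}. \<forall>s\<in>{0<..1}. l2 t s x = l2' t s x"
    using ae by eventually_elim auto
  have eq3: "AE x in law. \<forall>t\<in>{1..T}. \<forall>s\<in>{0<..1}. l3 t s x = l3' t s x"
    using ae by eventually_elim auto
  note m1 = measurable_l'[OF lam l1' eq1] note m2 = measurable_l'[OF lam l2' eq2]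
  note m3 = measurable_l'[OF lam l3' eq3] note mlam = measurable_lam[OF lam l2' eq2]
  have le: "AE x in series_law T p. \<forall>t\<in>{1..T}. \<forall>s\<in>{0<..1}. l1 t s x \<le> l2 t s x \<and> l3 t s x \<le> l2 t s x"
    unfolding series_law_eq
  proof (rule AE_completion, use ae in eventually_elim, intro ballI)
    fix x t s
    assume "\<forall>t\<in>{1..T}. \<forall>s\<in>{0<..1}. l2 t s x = l2' t s x \<and> l3 t s x = l3' t s x \<and>
      l2 t s x = l1 t s x + l3 t s x \<and> l3 t s x < \<infinity>" "t \<in> {1..T}" "s \<in> {0<..1::real}"
    then have "l2 t s x = l1 t s x + l3 t s x" by blast
    then show "l1 t s x \<le> l2 t s x \<and> l3 t s x \<le> l2 t s x" by simp
  qed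
  have conv1: "objective_converges T p lam l1"
    by (rule objective_converges_mono[OF _ conv], use le in eventually_elim) blast
  have conv3: "objective_converges T p lam l3"
    by (rule objective_converges_mono[OF _ conv], use le in eventually_elim) blast
  \<comment> \<open>The identities at the individual steps combine to one on the product because the
    exceptional set is measurable there; this is why it is stated for the versions.\<close>
  have split: "AE \<omega> in step_law \<Otimes>\<^sub>M law. \<forall>t\<in>{1..T}.
      l2' t (fst \<omega>) (snd \<omega>) = l1' t (fst \<omega>) (snd \<omega>) + l3' t (fst \<omega>) (snd \<omega>)"
  proof (rule AE_pair_measure)
    note [measurable] = m1 m2 m3
    show "{\<omega> \<in> space (step_law \<Otimes>\<^sub>M law). \<forall>t\<in>{1..T}.
        l2' t (fst \<omega>) (snd \<omega>) = l1' t (fst \<omega>) (snd \<omega>) + l3' t (fst \<omega>) (snd \<omega>)} \<in> sets (step_law \<Otimes>\<^sub>M law)"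
      by measurable
    show "AE s in step_law. AE x in law. \<forall>t\<in>{1..T}. l2' t (fst (s, x)) (snd (s, x)) =
        l1' t (fst (s, x)) (snd (s, x)) + l3' t (fst (s, x)) (snd (s, x))"
    proof (rule AE_I2)
      fix s assume "s \<in> space step_law"
      then have s: "s \<in> {0<..1}" by (simp add: space_restrict_space)
      show "AE x in law. \<forall>t\<in>{1..T}. l2' t (fst (s, x)) (snd (s, x)) =
          l1' t (fst (s, x)) (snd (s, x)) + l3' t (fst (s, x)) (snd (s, x))"
        using ae eq1
      proof (eventually_elim, unfold fst_conv snd_conv, intro ballI)
        fix x t
        assume "\<forall>t\<in>{1..T}. \<forall>s\<in>{0<..1}. l2 t s x = l2' t s x \<and> l3 t s x = l3' t s x \<and>
            l2 t s x = l1 t s x + l3 t s x \<and> l3 t s x < \<infinity>"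
          and "\<forall>t\<in>{1..T}. \<forall>s\<in>{0<..1}. l1 t s x = l1' t s x" and "t \<in> {1..T}"
        then have "l2 t s x = l2' t s x" "l3 t s x = l3' t s x" "l2 t s x = l1 t s x + l3 t s x"
          "l1 t s x = l1' t s x" using s by blast+
        then show "l2' t s x = l1' t s x + l3' t s x" by (simp only:)
      qed
    qed
  qed
  \<comment> \<open>\<open>enn2real\<close> is additive only on finite values. Convergence makes the
    weighted loss finite almost everywhere, so \<open>l2'\<close> can be infinite only where the
    weight is 0, and there both sides vanish.\<close>
  have fin: "AE \<omega> in step_law \<Otimes>\<^sub>M law.
      (\<Sum>t\<in>{1..T}. ennreal \<bar>lam (fst \<omega>)\<bar> * l2' t (fst \<omega>) (snd \<omega>)) \<noteq> \<infinity>"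
  proof (rule nn_integral_PInf_AE)
    note [measurable] = m2 mlam
    show "(\<lambda>\<omega>. \<Sum>t\<in>{1..T}. ennreal \<bar>lam (fst \<omega>)\<bar> * l2' t (fst \<omega>) (snd \<omega>)) \<in> borel_measurable (step_law \<Otimes>\<^sub>M law)"
      by measurable
    have "(\<integral>\<^sup>+\<omega>. (\<Sum>t\<in>{1..T}. ennreal \<bar>lam (fst \<omega>)\<bar> * l2' t (fst \<omega>) (snd \<omega>)) \<partial>(step_law \<Otimes>\<^sub>M law)) < \<infinity>"
      using conv by (simp only: objective_converges_iff[OF lam l2' eq2])
    then show "(\<integral>\<^sup>+\<omega>. (\<Sum>t\<in>{1..T}. ennreal \<bar>lam (fst \<omega>)\<bar> * l2' t (fst \<omega>) (snd \<omega>)) \<partial>(step_law \<Otimes>\<^sub>M law)) \<noteq> \<infinity>"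
      by (rule less_imp_neq)
  qed
  let ?h = "\<lambda>l \<omega>. \<Sum>t\<in>{1..T}. lam (fst \<omega>) * enn2real (l t (fst \<omega>) (snd \<omega>))"
  note i1 = objective_integrable[OF lam l1' eq1 conv1] note i2 = objective_integrable[OF lam l2' eq2 conv]
  note i3 = objective_integrable[OF lam l3' eq3 conv3]
  have "AE \<omega> in step_law \<Otimes>\<^sub>M law. ?h l2' \<omega> = ?h l1' \<omega> + ?h l3' \<omega>"
    using split fin
  proof eventually_elim
    fix \<omega> assume sp: "\<forall>t\<in>{1..T}. l2' t (fst \<omega>) (snd \<omega>) = l1' t (fst \<omega>) (snd \<omega>) + l3' t (fst \<omega>) (snd \<omega>)"
      and fin: "(\<Sum>t\<in>{1..T}. ennreal \<bar>lam (fst \<omega>)\<bar> * l2' t (fst \<omega>) (snd \<omega>)) \<noteq> \<infinity>"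
    have "lam (fst \<omega>) * enn2real (l2' t (fst \<omega>) (snd \<omega>)) =
        lam (fst \<omega>) * enn2real (l1' t (fst \<omega>) (snd \<omega>)) + lam (fst \<omega>) * enn2real (l3' t (fst \<omega>) (snd \<omega>))"
      if t: "t \<in> {1..T}" for t
    proof (cases "lam (fst \<omega>) = 0")
      case False
      have "ennreal \<bar>lam (fst \<omega>)\<bar> * l2' t (fst \<omega>) (snd \<omega>) \<le>
          (\<Sum>t\<in>{1..T}. ennreal \<bar>lam (fst \<omega>)\<bar> * l2' t (fst \<omega>) (snd \<omega>))"
        by (rule member_le_sum[OF t]) auto
      then have "ennreal \<bar>lam (fst \<omega>)\<bar> * l2' t (fst \<omega>) (snd \<omega>) \<noteq> \<infinity>"
        using fin by (metis infinity_ennreal_def top_unique)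
      then have "l2' t (fst \<omega>) (snd \<omega>) \<noteq> \<infinity>"
        using False by (auto simp: ennreal_mult_top)
      then show ?thesis
        using sp t by (simp add: enn2real_plus less_top[symmetric] distrib_left)
    qed simp
    then show "?h l2' \<omega> = ?h l1' \<omega> + ?h l3' \<omega>"
      unfolding sum.distrib[symmetric] by (intro sum.cong) auto
  qed
  then have "(\<integral>\<omega>. ?h l2' \<omega> \<partial>(step_law \<Otimes>\<^sub>M law)) = (\<integral>\<omega>. ?h l1' \<omega> + ?h l3' \<omega> \<partial>(step_law \<Otimes>\<^sub>M law))"
    using i1 i2 i3 by (intro integral_cong_AE borel_measurable_add borel_measurable_integrable)
  also have "\<dots> = (\<integral>\<omega>. ?h l1' \<omega> \<partial>(step_law \<Otimes>\<^sub>M law)) + (\<integral>\<omega>. ?h l3' \<omega> \<partial>(step_law \<Otimes>\<^sub>M law))"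
    by (rule Bochner_Integration.integral_add[OF i1 i3])
  finally show ?thesis
    using conv1 objective_eq_integral[OF lam l1' eq1 conv1] objective_eq_integral[OF lam l2' eq2 conv]
      objective_eq_integral[OF lam l3' eq3 conv3] by simp
qed

end

context diffused_series
begin

text \<open>Everything in this loss depends on the series through the coordinates 1 to
  \<open>t - 1\<close> alone, and \<open>condition\<close> keeps these; for \<open>t = 1\<close>
  there are none. This makes the additive constant a function of the condition.\<close>

lemma loss2_optimal_condition:
  assumes t: "t \<in> {1..T}"
  shows "loss2 T p q (optimal_net (condition t x)) t s (condition t x) =
    loss2 T p q (optimal_net x) t s x"
proof -
  have eq: "condition t x i = x i" if "i \<in> {1..t - 1}" for i
    using that by (auto simp: condition_def cond_idx_def)
  have "((condition t x)(t := v)) i = (x(t := v)) i" if "i \<in> {1..t}" for i v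
    using that eq[of i] by (cases "i = t") auto
  then have extend: "extend t (condition t x) v = extend t x v"
    and marg: "marginal T p t ((condition t x)(t := v)) = marginal T p t (x(t := v))" for v
    by (auto intro: restrict_ext marginal_cong)
  have marg': "marginal T p (t - 1) (condition t x) = marginal T p (t - 1) x"
    by (rule marginal_cong) (rule eq)
  have "diffused_density T p q t s (condition t x) = diffused_density T p q t s x"
    by (rule ext) (simp only: diffused_density_def extend marg marg')
  moreover have "next_density T p t (condition t x) = next_density T p t x"
    by (rule ext) (simp only: next_density_def marg marg')
  ultimately show ?thesis
    by (simp only: loss2_def optimal_net_def extend)
qed

end

lemma measurable_condition:
  assumes t: "t \<in> {1..T}"
  shows "condition t \<in> measurable (block_space {1..T}) (block_space (cond_idx t))"
  unfolding condition_def
proof (rule measurable_restrict)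
  \<comment> \<open>Index 0 occurs only for \<open>t = 1\<close>; it is not a coordinate of the
    series, and its entry is the constant 0.\<close>
  fix i assume "i \<in> cond_idx t"
  then show "(\<lambda>x. (x(0 := 0)) i) \<in> measurable (block_space {1..T}) lborel"
    using t by (cases "i = 0") (auto simp: cond_idx_def split: if_splits)
qed

lemma is_arg_min_add_const:
  fixes f g :: "'b \<Rightarrow> real"
  assumes "\<And>\<theta>. P \<theta> \<Longrightarrow> g \<theta> = f \<theta> + C"
  shows "is_arg_min f P \<theta> \<longleftrightarrow> is_arg_min g P \<theta>"
  using assms unfolding is_arg_min_def by auto

theorem theorem1:
  fixes T :: nat
    and p :: "(nat \<Rightarrow> 'a::euclidean_space) \<Rightarrow> real"
    and N :: "'w measure"
    and W :: "nat \<Rightarrow> real \<Rightarrow> 'w \<Rightarrow> nat \<Rightarrow> 'a"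
    and f :: "nat \<Rightarrow> real \<Rightarrow> (nat \<Rightarrow> 'a) \<Rightarrow> nat \<Rightarrow> 'a"
    and g :: "real \<Rightarrow> real"
    and X :: "nat \<Rightarrow> (nat \<Rightarrow> 'a) \<Rightarrow> real \<Rightarrow> 'w \<Rightarrow> nat \<Rightarrow> 'a"
    and q :: "nat \<Rightarrow> real \<Rightarrow> (nat \<Rightarrow> 'a) \<Rightarrow> (nat \<Rightarrow> 'a) \<Rightarrow> real"
    and M :: "'\<theta> \<Rightarrow> nat \<Rightarrow> real \<Rightarrow> (nat \<Rightarrow> 'a) \<Rightarrow> (nat \<Rightarrow> 'a) \<Rightarrow> nat \<Rightarrow> 'a"
    and lam :: "real \<Rightarrow> real"
  assumes p_measurable: "p \<in> borel_measurable (block_space {1..T})"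
    and p_nonneg: "\<And>x. p x \<ge> 0"
    and p_prob: "prob_space (density (block_space {1..T}) (\<lambda>x. ennreal (p x)))"
    and noise: "prob_space N" "\<And>t. t \<in> {1..T} \<Longrightarrow> brownian_motion N {1..t} (W t)"
    and drift: "\<And>t s. t \<in> {1..T} \<Longrightarrow> s \<in> {0..1} \<Longrightarrow> block_affine {1..t} (f t s)"
    and diffusion: "set_borel_measurable borel {0..1} g"
    and sde: "\<And>t x. t \<in> {1..T} \<Longrightarrow> x \<in> space (block_space {1..t}) \<Longrightarrow>
                sde_solution N {1..t} (W t) (f t) g x (X t x)"
    and kernel: "\<And>t s x. t \<in> {1..T} \<Longrightarrow> s \<in> {0<..1} \<Longrightarrow> x \<in> space (block_space {1..t}) \<Longrightarrow>
                distributed N (block_space {1..t}) (X t x s) (\<lambda>y. ennreal (q t s x y))"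
    and kernel_gaussian: "\<And>t s. t \<in> {1..T} \<Longrightarrow> s \<in> {0<..1} \<Longrightarrow> gaussian_transition {1..t} (q t s)"
    and kernel_measurable: "\<And>t. t \<in> {1..T} \<Longrightarrow>
                (\<lambda>(s, x, y). q t s x y) \<in> borel_measurable
                  (restrict_space borel {0<..1} \<Otimes>\<^sub>M block_space {1..t} \<Otimes>\<^sub>M block_space {1..t})"
    and network: "\<And>\<theta> t. t \<in> {1..T} \<Longrightarrow>
                (\<lambda>(s, y, c). M \<theta> t s y c) \<in> measurable
                  (restrict_space borel {0..1} \<Otimes>\<^sub>M block_space {1..t} \<Otimes>\<^sub>M block_space (cond_idx t))
                  (block_space {1..t})"
    and weight: "set_borel_measurable borel {0..1} lam"
  shows "(\<exists>c :: nat \<Rightarrow> real \<Rightarrow> (nat \<Rightarrow> 'a) \<Rightarrow> real.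
            AE x in series_law T p. \<forall>t\<in>{1..T}. \<forall>s\<in>{0<..1}. \<forall>\<theta>.
              loss2 T p q (M \<theta>) t s x = loss1 T p q (M \<theta>) t s x + ennreal (c t s (condition t x)))
       \<and> (\<exists>C :: real. \<forall>\<theta>. objective_converges T p lam (loss2 T p q (M \<theta>)) \<longrightarrow>
            objective_converges T p lam (loss1 T p q (M \<theta>)) \<and>
            objective T p lam (loss2 T p q (M \<theta>)) = objective T p lam (loss1 T p q (M \<theta>)) + C)
       \<and> (\<forall>\<Theta>. (\<forall>\<theta>\<in>\<Theta>. objective_converges T p lam (loss2 T p q (M \<theta>))) \<longrightarrow>
            (\<forall>\<theta>. is_arg_min (\<lambda>\<theta>. objective T p lam (loss1 T p q (M \<theta>))) (\<lambda>\<theta>. \<theta> \<in> \<Theta>) \<theta> \<longleftrightarrow>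
                 is_arg_min (\<lambda>\<theta>. objective T p lam (loss2 T p q (M \<theta>))) (\<lambda>\<theta>. \<theta> \<in> \<Theta>) \<theta>))"
proof -
  \<comment> \<open>The mass is that of the law of \<open>X t x s\<close>, whose density is
    \<open>q t s x\<close>.\<close>
  have q_prob: "(\<integral>\<^sup>+y. ennreal (q t s x y) \<partial>block_space {1..t}) = 1"
    if t: "t \<in> {1..T}" and s: "s \<in> {0<..1}" and x: "x \<in> extensional {1..t}" for t s x
  proof -
    have d: "distributed N (block_space {1..t}) (X t x s) (\<lambda>y. ennreal (q t s x y))"
      using kernel[OF t s] x by (simp only: space_block_space)
    interpret D: prob_space "density (block_space {1..t}) (\<lambda>y. ennreal (q t s x y))"
      unfolding distributed_distr_eq_density[OF d, symmetric]
      by (rule prob_space.prob_space_distr[OF noise(1) distributed_measurable[OF d]])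
    have "(\<integral>\<^sup>+y. ennreal (q t s x y) \<partial>block_space {1..t}) =
        emeasure (density (block_space {1..t}) (\<lambda>y. ennreal (q t s x y))) (space (block_space {1..t}))"
      using distributed_borel_measurable[OF d] by (subst emeasure_density) (auto intro!: nn_integral_cong)
    then show ?thesis using D.emeasure_space_1 by (simp only: space_density)
  qed
  interpret diffused_series T p q
    using p_measurable p_nonneg p_prob kernel_gaussian kernel_measurable q_prob
    by (intro diffused_series.intro series_density.intro diffused_series_axioms.intro)
  \<comment> \<open>The denoising loss of the exact conditional score, the part of
    \<open>loss2\<close> that no parameter influences.\<close>
  define l3 where "l3 t s x = loss2 T p q (optimal_net x) t s x" for t s x
  have net: "(\<lambda>y. M \<theta> t s y (condition t x) i) \<in> borel_measurable (block_space {1..t})"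
    if t: "t \<in> {1..T}" and s: "s \<in> {0<..1}" and i: "i \<in> {1..t}" for \<theta> t s x i
  proof -
    have "(\<lambda>y. (s, y, condition t x)) \<in> measurable (block_space {1..t})
        (restrict_space borel {0..1} \<Otimes>\<^sub>M block_space {1..t} \<Otimes>\<^sub>M block_space (cond_idx t))"
      using s by (auto intro!: measurable_Pair simp: space_restrict_space space_block_space condition_def)
    from measurable_compose[OF measurable_compose[OF this network[OF t]] measurable_component_singleton[OF i]]
    show ?thesis by simp
  qed
  have main: "l3 t s x < \<infinity> \<and> loss2 T p q (M \<theta>) t s x = loss1 T p q (M \<theta>) t s x + l3 t s x"
    if "t \<in> {1..T}" "s \<in> {0<..1}" "regular t x" for \<theta> t s x
    unfolding l3_def using loss2_optimal_finite[OF that] loss_decomposition[OF that, of "M \<theta>", OF net[OF that(1,2)]]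
    by blast
  \<comment> \<open>The witness evaluates \<open>l3\<close> at the condition alone, and
    \<open>enn2real\<close> loses nothing because \<open>l3\<close> is finite at regular conditions.
    The exceptional set is that of \<open>AE_regular\<close>, hence the same for all
    parameters.\<close>
  have part1: "AE x in series_law T p. \<forall>t\<in>{1..T}. \<forall>s\<in>{0<..1}. \<forall>\<theta>.
      loss2 T p q (M \<theta>) t s x = loss1 T p q (M \<theta>) t s x + ennreal (enn2real (l3 t s (condition t x)))"
    unfolding series_law_eq
  proof (rule AE_completion, use AE_regular in eventually_elim, intro ballI allI)
    fix x t s \<theta> assume "\<forall>t\<in>{1..T}. regular t x" and t: "t \<in> {1..T}" and s: "s \<in> {0<..1::real}"
    then have "l3 t s x < \<infinity> \<and> loss2 T p q (M \<theta>) t s x = loss1 T p q (M \<theta>) t s x + l3 t s x"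
      by (intro main) auto
    moreover have "l3 t s (condition t x) = l3 t s x"
      unfolding l3_def by (rule loss2_optimal_condition[OF t])
    ultimately show "loss2 T p q (M \<theta>) t s x = loss1 T p q (M \<theta>) t s x
        + ennreal (enn2real (l3 t s (condition t x)))" by simp
  qed
  have lam: "lam \<in> borel_measurable steps"
  proof -
    have "(\<lambda>s. indicator {0..1} s *\<^sub>R lam s) \<in> borel_measurable steps"
      using weight unfolding set_borel_measurable_def by (rule measurable_restrict_space1)
    then show ?thesis
      by (subst measurable_cong[where g = "\<lambda>s. indicator {0..1} s *\<^sub>R lam s"])
        (auto simp: space_restrict_space)
  qed
  have net3: "(\<lambda>(s, x, y). M \<theta> t s y (condition t x) i)
      \<in> borel_measurable (steps \<Otimes>\<^sub>M block_space {1..T} \<Otimes>\<^sub>M block_space {1..t})"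
    if t: "t \<in> {1..T}" and i: "i \<in> {1..t}" for \<theta> t i
  proof -
    let ?N = "steps \<Otimes>\<^sub>M (block_space {1..T} :: (nat \<Rightarrow> 'a) measure) \<Otimes>\<^sub>M (block_space {1..t} :: (nat \<Rightarrow> 'a) measure)"
    \<comment> \<open>The network is measurable over the closed interval and is pulled back along
      the inclusion of the half-open one.\<close>
    have "(\<lambda>\<omega>. fst \<omega>) \<in> measurable ?N (restrict_space borel {0..1})"
    proof (rule measurable_restrict_space2)
      show "fst \<in> measurable ?N borel"
        by (rule measurable_compose[OF measurable_fst measurable_restrict_space1]) simp
    qed (auto simp: space_pair_measure space_restrict_space)
    moreover have "(\<lambda>\<omega>. snd (snd \<omega>)) \<in> measurable ?N (block_space {1..t})"
      by measurable
    moreover have "(\<lambda>\<omega>. condition t (fst (snd \<omega>))) \<in> measurable ?N (block_space (cond_idx t))"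
      by (rule measurable_compose[OF _ measurable_condition[OF t]]) measurable
    ultimately have "(\<lambda>\<omega>. (fst \<omega>, snd (snd \<omega>), condition t (fst (snd \<omega>)))) \<in> measurable ?N
        (restrict_space borel {0..1} \<Otimes>\<^sub>M block_space {1..t} \<Otimes>\<^sub>M block_space (cond_idx t))"
      by (intro measurable_Pair)
    from measurable_compose[OF measurable_compose[OF this network[OF t]] measurable_component_singleton[OF i]]
    show ?thesis by (simp add: split_beta')
  qed
  \<comment> \<open>The constant is the objective of \<open>l3\<close>. Its convergence follows from
    \<open>l3 \<le> loss2\<close> almost everywhere, as soon as one parameter has a convergent
    denoising objective.\<close>
  have part2: "objective_converges T p lam (loss1 T p q (M \<theta>)) \<and>
      objective T p lam (loss2 T p q (M \<theta>)) = objective T p lam (loss1 T p q (M \<theta>)) + objective T p lam l3"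
    if conv: "objective_converges T p lam (loss2 T p q (M \<theta>))" for \<theta>
  proof (rule objective_add[OF lam _ _ _ conv])
    let ?m = "\<lambda>t s x y. M \<theta> t s y (condition t x)"
    show "(\<lambda>(s, x). loss2_version t (?m t) s x) \<in> borel_measurable (steps \<Otimes>\<^sub>M block_space {1..T})"
      if "t \<in> {1..T}" for t
      using measurable_loss2_version[OF that net3[OF that]] .
    show "(\<lambda>(s, x). loss2_version t (mix_score_of t) s x) \<in> borel_measurable (steps \<Otimes>\<^sub>M block_space {1..T})"
      if "t \<in> {1..T}" for t
      using measurable_loss2_version[OF that measurable_mix_score_of[OF that]] .
    show "AE x in law. \<forall>t\<in>{1..T}. \<forall>s\<in>{0<..1}.
        loss2 T p q (M \<theta>) t s x = loss2_version t (?m t) s x \<and>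
        l3 t s x = loss2_version t (mix_score_of t) s x \<and>
        loss2 T p q (M \<theta>) t s x = loss1 T p q (M \<theta>) t s x + l3 t s x \<and> l3 t s x < \<infinity>"
      using AE_regular AE_space
    proof (eventually_elim, intro ballI)
      fix x t s assume "\<forall>t\<in>{1..T}. regular t x" "x \<in> space law"
        and t: "t \<in> {1..T}" and s: "s \<in> {0<..1::real}"
      then have x: "regular t x" "x \<in> space (block_space {1..T})" by auto
      have "loss2 T p q (M \<theta>) t s x = loss2_version t (?m t) s x"
        by (rule loss2_eq_version[OF t s x(2) net3[OF t]]) auto
      moreover have "l3 t s x = loss2_version t (mix_score_of t) s x"
        unfolding l3_def
      proof (rule loss2_eq_version[OF t s x(2) measurable_mix_score_of[OF t]])
        show "optimal_net x t s y (condition t x) i = mix_score_of t s x y i"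
          if "y \<in> extensional {1..t}" "i \<in> {1..t}" for y i
          unfolding optimal_net_def by (rule score_diffused[OF t s x(1) that])
      qed
      ultimately show "loss2 T p q (M \<theta>) t s x = loss2_version t (?m t) s x \<and>
          l3 t s x = loss2_version t (mix_score_of t) s x \<and>
          loss2 T p q (M \<theta>) t s x = loss1 T p q (M \<theta>) t s x + l3 t s x \<and> l3 t s x < \<infinity>"
        using main[OF t s x(1)] by blast
    qed
  qed
  show ?thesis
  proof (intro conjI allI impI)
    show "\<exists>c. AE x in series_law T p. \<forall>t\<in>{1..T}. \<forall>s\<in>{0<..1}. \<forall>\<theta>.
        loss2 T p q (M \<theta>) t s x = loss1 T p q (M \<theta>) t s x + ennreal (c t s (condition t x))"
      using part1 by (rule exI[where x = "\<lambda>t s d. enn2real (l3 t s d)"])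
    show "\<exists>C. \<forall>\<theta>. objective_converges T p lam (loss2 T p q (M \<theta>)) \<longrightarrow>
        objective_converges T p lam (loss1 T p q (M \<theta>)) \<and>
        objective T p lam (loss2 T p q (M \<theta>)) = objective T p lam (loss1 T p q (M \<theta>)) + C"
      using part2 by blast
    show "is_arg_min (\<lambda>\<theta>. objective T p lam (loss1 T p q (M \<theta>))) (\<lambda>\<theta>. \<theta> \<in> \<Theta>) \<theta> \<longleftrightarrow>
        is_arg_min (\<lambda>\<theta>. objective T p lam (loss2 T p q (M \<theta>))) (\<lambda>\<theta>. \<theta> \<in> \<Theta>) \<theta>"
      if "\<forall>\<theta>\<in>\<Theta>. objective_converges T p lam (loss2 T p q (M \<theta>))" for \<Theta> \<theta>
      using that part2 by (intro is_arg_min_add_const[where C = "objective T p lam l3"]) blast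
  qed
qed

end
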